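(* Let $C$ be a ternary linear $[n,k,d]$ code (a $k$-dimensional subspace of $\mathbb{F}_3^n$ with minimum nonzero weight $d$) that is a two-weight code, i.e. its codewords have exactly two distinct nonzero Hamming weights. Let $C^{\perp}$ be its dual code, with minimum weight $d^{\perp}$. Suppose $C$ satisfies the AM-condition, i.e. there exists $t\in\mathbb{N}$ with $$d^{\perp}-t=\#\{u \mid C_u\neq\emptyset,\ 0<u\leq n-t\},$$ where $C_u=\{c\in C\mid \mathrm{wt}(c)=u\}$. Then one of the following holds: (1) $d^{\perp}=5$ and $C$ is the $[11,5,6]$ code that is the dual of the ternary Golay code, with $t=4$; or (2) $d^{\perp}\leq 4$ and $t\leq 3$.
   Context: $C^{\perp}$ is the dual of $C$ with respect to the standard inner product on $\mathbb{F}_3^n$; it is an $[n,n-k,d^{\perp}]$ code. The ternary Golay code is the $[11,6,5]$ perfect ternary code; its dual is an $[11,5,6]$ code. Under the AM-condition, the Assmus--Mattson theorem guarantees that for every weight $u$ the support design $D_u$ (the collection, with repeated blocks allowed, of supports of codewords of weight $u$ in $C$) and every support design $D^{\perp}_w$ of $C^{\perp}$ are $t$-designs. *)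

theory Defs
  imports "HOL-Analysis.Cartesian_Space" "HOL-Library.Numeral_Type"
begin

definition hamming_weight :: "('f::field) ^ 'n \<Rightarrow> nat" where
  "hamming_weight x = card {i. x $ i \<noteq> 0}"

definition hamming_dist :: "('f::field) ^ 'n \<Rightarrow> 'f ^ 'n \<Rightarrow> nat" where
  "hamming_dist x y = card {i. x $ i \<noteq> y $ i}"

definition words_of_weight :: "(('f::field) ^ 'n) set \<Rightarrow> nat \<Rightarrow> ('f ^ 'n) set" where
  "words_of_weight C u = {c \<in> C. hamming_weight c = u}"

text \<open>A code without nonzero words has no minimum weight, so this is a relation.\<close>

definition has_min_weight :: "(('f::field) ^ 'n) set \<Rightarrow> nat \<Rightarrow> bool" where
  "has_min_weight C d \<longleftrightarrow>
     (\<exists>c\<in>C. c \<noteq> 0 \<and> hamming_weight c = d) \<and> (\<forall>c\<in>C. c \<noteq> 0 \<longrightarrow> d \<le> hamming_weight c)"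

definition linear_code :: "nat \<Rightarrow> nat \<Rightarrow> nat \<Rightarrow> (('f::field) ^ 'n) set \<Rightarrow> bool" where
  "linear_code n k d C \<longleftrightarrow>
     CARD('n) = n \<and> vec.subspace C \<and> vec.dim C = k \<and> has_min_weight C d"

definition dual_code :: "(('f::field) ^ 'n) set \<Rightarrow> ('f ^ 'n) set" where
  "dual_code C = {y. \<forall>x\<in>C. (\<Sum>i\<in>UNIV. x $ i * y $ i) = 0}"

definition two_weight_code :: "(('f::field) ^ 'n) set \<Rightarrow> bool" where
  "two_weight_code C \<longleftrightarrow> card {u. 0 < u \<and> words_of_weight C u \<noteq> {}} = 2"

text \<open>The condition for a given \<open>t\<close>; the subtractions are those of the integers.\<close>

definition AM_condition :: "(('f::field) ^ 'n) set \<Rightarrow> nat \<Rightarrow> nat \<Rightarrow> bool" where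
  "AM_condition C dperp t \<longleftrightarrow>
     int dperp - int t =
     int (card {u. words_of_weight C u \<noteq> {} \<and> 0 < u \<and> int u \<le> int CARD('n) - int t})"

definition perfect_code :: "(('f::field) ^ 'n) set \<Rightarrow> bool" where
  "perfect_code C \<longleftrightarrow> (\<exists>e. \<forall>x. \<exists>!c. c \<in> C \<and> hamming_dist x c \<le> e)"

definition monomially_equivalent ::
    "(('f::field) ^ 'm) set \<Rightarrow> ('f ^ 'n) set \<Rightarrow> bool" where
  "monomially_equivalent C D \<longleftrightarrow>
     (\<exists>(p :: 'n \<Rightarrow> 'm) (a :: 'n \<Rightarrow> 'f). bij p \<and> (\<forall>i. a i \<noteq> 0) \<and>
        D = (\<lambda>x. \<chi> i. a i * x $ p i) ` C)"

text \<open>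
  The cyclic code of length 11 with generator polynomial \<open>X^5 + X^4 - X^3 + X^2 - 1\<close>, a divisor
  of \<open>X^11 - 1\<close> over the field with three elements.  Coordinates are indexed by the numeral
  type \<open>11\<close>, whose arithmetic is modulo 11, so \<open>i - s\<close> is a cyclic shift.
\<close>

definition golay_generator :: "11 \<Rightarrow> 'f::field" where
  "golay_generator i = (if i \<in> {2, 4, 5} then 1 else if i \<in> {0, 3} then - 1 else 0)"

definition cyclic_golay_code :: "(('f::field) ^ 11) set" where
  "cyclic_golay_code = vec.span (range (\<lambda>s. \<chi> i. golay_generator (i - s)))"

text \<open>
  \<open>The\<close> ternary Golay code is the perfect [11,6,5] code, which is unique only up to monomial
  equivalence; the last conjunct pins down the equivalence class by an explicit representative.
\<close>

definition ternary_golay_code :: "(('f::field) ^ 'n) set \<Rightarrow> bool" where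
  "ternary_golay_code G \<longleftrightarrow>
     CARD('f) = 3 \<and> linear_code 11 6 5 G \<and> perfect_code G \<and>
     monomially_equivalent (cyclic_golay_code :: ('f ^ 11) set) G"

end

theory Submission
  imports Defs "HOL-Computational_Algebra.Primes"
begin

text \<open>
  If the dual code has minimum weight greater than \<open>j\<close>, the words of \<open>C\<close> are equidistributed on every
  \<open>j\<close> coordinates, so the number \<open>X\<close> of zeros of a random word has the first \<open>j\<close> factorial moments of
  a binomial variable with success probability \<open>1/3\<close>. Two nonzero weights mean that \<open>X\<close> takes only the
  values \<open>x1\<close>, \<open>x2\<close> and \<open>n\<close>; hence \<open>(X - x1) (X - x2) (X - n) g(X)\<close> has expectation zero for every
  polynomial \<open>g\<close>. With \<open>g = 1\<close>, \<open>X\<close>, \<open>X (X - 1)\<close> this rules out dual distance above 5, and for dual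
  distance 5 it leaves, together with divisibility, only \<open>n = 11\<close>, \<open>q = 243\<close> and the weights 6 and 9.
  For dual distance 4 and \<open>t = 4\<close> all weights would be at least \<open>n - 3\<close>, and the equation for \<open>g = 1\<close>
  leaves only \<open>n = 5\<close>, excluded by the Plotkin bound on the dual, and \<open>n = 8\<close>, where \<open>q = 45\<close>.

  A code of length 11 with 243 words, weights 6 and 9 and dual distance 5 has a systematic generator
  matrix \<open>(I | S | 1)\<close> up to scaling, where \<open>S\<close> has zero diagonal and any two rows of \<open>S\<close> agree in
  exactly one of the three remaining columns. This determines \<open>S\<close> up to permutations and column signs.
\<close>

section \<open>Duality of subspaces\<close>

definition dot :: "('f::field) ^ 'n \<Rightarrow> 'f ^ 'n \<Rightarrow> 'f" where
  "dot x y = (\<Sum>i\<in>UNIV. x $ i * y $ i)"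

definition zeros :: "('f::field) ^ 'n \<Rightarrow> 'n set" where
  "zeros x = {i. x $ i = 0}"

lemma dot_commute: "dot x y = dot y x"
  by (simp add: dot_def mult.commute)

lemma dot_add: "dot (x + y) z = dot x z + dot y z"
  by (simp add: dot_def sum.distrib distrib_right)

lemma dot_scale: "dot (a *s x) z = a * dot x z"
  by (simp add: dot_def sum_distrib_left mult.assoc)

lemma dot_zero [simp]: "dot 0 z = 0" "dot z 0 = 0"
  by (simp_all add: dot_def)

lemma dot_axis: "dot x (axis i 1) = x $ i"
  by (simp add: dot_def axis_def if_distrib cong: if_cong)

lemma dual_code_eq: "dual_code C = {y. \<forall>x\<in>C. dot x y = 0}"
  by (simp add: dual_code_def dot_def)

lemma subspace_dual_code: "vec.subspace (dual_code C)"
proof -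
  have "dual_code C = {y. \<forall>x\<in>C. dot y x = 0}" by (simp add: dual_code_eq dot_commute)
  then show ?thesis by (auto simp: vec.subspace_def dot_add dot_scale)
qed

lemma dual_code_UNIV: "dual_code UNIV = {0 :: ('f::field) ^ 'n}"
proof -
  have "y = 0" if "\<forall>x. dot x y = 0" for y :: "'f ^ 'n"
    using that dot_axis[of y] by (simp add: vec_eq_iff dot_commute[of y])
  then show ?thesis by (auto simp: dual_code_eq)
qed

lemma subset_dual_dual: "C \<subseteq> dual_code (dual_code C)"
  by (auto simp: dual_code_eq dot_commute)

lemma hamming_weight_zeros:
  "hamming_weight (x :: ('f::field) ^ 'n) = CARD('n) - card (zeros x)"
proof -
  have "{i. x $ i \<noteq> 0} = UNIV - zeros x" by (auto simp: zeros_def)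
  then show ?thesis by (simp add: hamming_weight_def card_Diff_subset)
qed

lemma card_zeros:
  "card (zeros (x :: ('f::field) ^ 'n)) = CARD('n) - hamming_weight x"
  "card (zeros x) + hamming_weight x = CARD('n)"
  using card_mono[of UNIV "zeros x"] by (auto simp: hamming_weight_zeros)

text \<open>Some \<open>u\<close> in \<open>V\<close> has inner product 1 with \<open>y\<close>, so
  \<open>V\<close> is the direct sum of the line through \<open>u\<close> and the kernel.\<close>

lemma card_functional_kernel:
  fixes V :: "(('f::{field,finite}) ^ 'n) set"
  assumes "vec.subspace V" and "y \<notin> dual_code V"
  shows "CARD('f) * card {v \<in> V. dot v y = 0} = card V"
proof -
  let ?K = "{v \<in> V. dot v y = 0}"
  obtain u0 where u0: "u0 \<in> V" "dot u0 y \<noteq> 0" using assms(2) by (auto simp: dual_code_eq)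
  define u where "u = inverse (dot u0 y) *s u0"
  have u: "u \<in> V" "dot u y = 1"
    using u0 assms(1) by (auto simp: u_def dot_scale vec.subspace_scale)
  have "bij_betw (\<lambda>(a, v). a *s u + v) (UNIV \<times> ?K) V"
  proof (rule bij_betwI[where g = "\<lambda>w. (dot w y, w - dot w y *s u)"])
    show "(\<lambda>(a, v). a *s u + v) \<in> UNIV \<times> ?K \<rightarrow> V"
      using u assms(1) by (auto simp: vec.subspace_add vec.subspace_scale)
    have "dot (w - dot w y *s u) y = 0" for w
      using dot_add[of "w - dot w y *s u" "dot w y *s u" y] u by (simp add: dot_scale)
    then show "(\<lambda>w. (dot w y, w - dot w y *s u)) \<in> V \<rightarrow> UNIV \<times> ?K"
      using u assms(1) by (auto simp: vec.subspace_diff vec.subspace_scale)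
  qed (auto simp: dot_add dot_scale u)
  from bij_betw_same_card[OF this] show ?thesis by (simp add: card_cartesian_product)
qed

text \<open>Double counting of the orthogonal pairs between \<open>A\<close> and \<open>B\<close>.
  Allowing two arbitrary subspaces gives both the size of the dual and the equidistribution on
  coordinates.\<close>

lemma card_subspace_duality:
  fixes A B :: "(('f::{field,finite}) ^ 'n) set"
  assumes A: "vec.subspace A" and B: "vec.subspace B"
  shows "card A * card (B \<inter> dual_code A) = card B * card (A \<inter> dual_code B)"
proof -
  let ?p = "CARD('f)"
  \<comment> \<open>A \<open>y\<close> orthogonal to \<open>V\<close> contributes
    \<open>card V\<close>, any other \<open>card V\<close> divided by \<open>?p\<close>.
    Multiplication by \<open>?p\<close> clears the division, and the last summand is symmetric in
    \<open>V\<close> and \<open>W\<close>, so it cancels between the two counts.\<close>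
  have count: "?p * (\<Sum>y\<in>W. card {v \<in> V. dot v y = 0})
      = (?p - 1) * (card V * card (W \<inter> dual_code V)) + card V * card W"
    if V: "vec.subspace V" for V W :: "('f ^ 'n) set"
  proof -
    have p: "?p \<ge> 1" using finite_UNIV_card_ge_0[where 'a='f] by simp
    have "?p * (\<Sum>y\<in>W. card {v \<in> V. dot v y = 0})
       = (\<Sum>y\<in>W. (if y \<in> dual_code V then (?p - 1) * card V else 0) + card V)"
      unfolding sum_distrib_left
    proof (rule sum.cong)
      fix y assume "y \<in> W"
      have "{v \<in> V. dot v y = 0} = V" if "y \<in> dual_code V" using that by (auto simp: dual_code_eq)
      then show "?p * card {v \<in> V. dot v y = 0}
        = (if y \<in> dual_code V then (?p - 1) * card V else 0) + card V"
        using card_functional_kernel[OF V] p by (auto simp: algebra_simps diff_mult_distrib2)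
    qed simp
    also have "\<dots> = (?p - 1) * (card V * card (W \<inter> dual_code V)) + card V * card W"
      by (simp add: sum.distrib sum.inter_restrict[symmetric] algebra_simps)
    finally show ?thesis .
  qed
  have "(\<Sum>y\<in>B. card {v \<in> A. dot v y = 0}) = (\<Sum>v\<in>A. card {y \<in> B. dot y v = 0})"
    using sum.swap_restrict[of A B "\<lambda>v y. 1::nat" "\<lambda>v y. dot v y = 0"]
    by (simp add: dot_commute)
  then have "(?p - 1) * (card A * card (B \<inter> dual_code A)) = (?p - 1) * (card B * card (A \<inter> dual_code B))"
    using count[OF A, of B] count[OF B, of A] unfolding mult.commute[of "card A" "card B"] by (simp only: add_right_cancel)
  moreover have "?p - 1 \<noteq> 0"
    using card_mono[of UNIV "{0, 1 :: 'f}"] by simp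
  ultimately show ?thesis by (metis mult_left_cancel)
qed

lemma card_dual_code:
  fixes C :: "(('f::{field,finite}) ^ 'n) set"
  assumes "vec.subspace C"
  shows "card C * card (dual_code C) = CARD('f) ^ CARD('n)"
  using card_subspace_duality[OF assms vec.subspace_UNIV] vec.subspace_0[OF assms]
  by (simp add: dual_code_UNIV)

lemma dual_dual_code:
  fixes C :: "(('f::{field,finite}) ^ 'n) set"
  assumes "vec.subspace C"
  shows "dual_code (dual_code C) = C"
proof -
  have "card C * card (dual_code C) = card (dual_code (dual_code C)) * card (dual_code C)"
    using card_dual_code[OF assms] card_dual_code[OF subspace_dual_code[of C]]
    by (simp add: mult.commute)
  moreover have "card (dual_code C) \<noteq> 0" 
    using vec.subspace_0[OF subspace_dual_code[of C]] by auto
  ultimately have "card C = card (dual_code (dual_code C))" by simp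
  then show ?thesis using card_subset_eq[OF _ subset_dual_dual] by (metis finite)
qed

section \<open>Words vanishing on a set of coordinates\<close>

lemma card_vec_support_subset:
  "card {x :: ('f::{field,finite}) ^ 'n. \<forall>i. i \<notin> T \<longrightarrow> x $ i = 0} = CARD('f) ^ card T"
proof -
  have "bij_betw (\<lambda>x. restrict (($) x) T) {x :: 'f ^ 'n. \<forall>i. i \<notin> T \<longrightarrow> x $ i = 0} (T \<rightarrow>\<^sub>E UNIV)"
  proof (rule bij_betwI[where g = "\<lambda>f. \<chi> i. if i \<in> T then f i else 0"])
    show "restrict (($) (\<chi> i. if i \<in> T then f i else 0)) T = f"
      if "f \<in> T \<rightarrow>\<^sub>E UNIV" for f :: "'n \<Rightarrow> 'f"
      using PiE_arb[OF that] by (auto simp: fun_eq_iff)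
  qed (auto simp: vec_eq_iff)
  then show ?thesis by (simp add: bij_betw_same_card card_PiE)
qed

text \<open>Duality is applied to the space \<open>?U\<close> of words supported in
  \<open>T\<close>: it meets the dual code only in 0, as its words have weight at most
  \<open>card T\<close>, and its dual consists of the words vanishing on \<open>T\<close>.\<close>

lemma card_vanishing_words:
  fixes C :: "(('f::{field,finite}) ^ 'n) set"
  assumes C: "vec.subspace C" and d: "\<And>y. y \<in> dual_code C \<Longrightarrow> y \<noteq> 0 \<Longrightarrow> card T < hamming_weight y"
  shows "CARD('f) ^ card T * card {c \<in> C. T \<subseteq> zeros c} = card C"
proof -
  let ?U = "{x :: 'f ^ 'n. \<forall>i. i \<notin> T \<longrightarrow> x $ i = 0}"
  have U: "vec.subspace ?U" by (auto simp: vec.subspace_def)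
  have "?U \<inter> dual_code C = {0}"
  proof -
    have "y = 0" if "y \<in> ?U" "y \<in> dual_code C" for y
    proof (rule ccontr)
      assume "y \<noteq> 0"
      then have "card T < hamming_weight y" using d that by blast
      moreover have "hamming_weight y \<le> card T"
        unfolding hamming_weight_def using that by (intro card_mono) auto
      ultimately show False by simp
    qed
    then show ?thesis using vec.subspace_0[OF U] vec.subspace_0[OF subspace_dual_code[of C]] by auto
  qed
  moreover have "C \<inter> dual_code ?U = {c \<in> C. T \<subseteq> zeros c}"
  proof -
    have "c \<in> dual_code ?U \<longleftrightarrow> T \<subseteq> zeros c" for c
    proof
      assume *: "c \<in> dual_code ?U"
      show "T \<subseteq> zeros c"
      proof
        fix i assume "i \<in> T"
        then have "axis i 1 \<in> ?U" by (auto simp: axis_def)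
        then have "dot (axis i 1) c = 0" using * by (simp add: dual_code_eq)
        then show "i \<in> zeros c" by (simp add: zeros_def dot_commute[of "axis i 1"] dot_axis)
      qed
    next
      assume "T \<subseteq> zeros c"
      then show "c \<in> dual_code ?U"
        by (fastforce simp: dual_code_eq dot_def zeros_def intro!: sum.neutral)
    qed
    then show ?thesis by auto
  qed
  ultimately show ?thesis
    using card_subspace_duality[OF C U] by (simp add: card_vec_support_subset)
qed

section \<open>Cardinality of a subspace from its dimension\<close>

lemma card_vec_span_independent:
  fixes B :: "(('f::{field,finite}) ^ 'n) set"
  assumes "vec.independent B"
  shows "card (vec.span B) = CARD('f) ^ card B"
proof -
  have "finite B" by simp
  then show ?thesis using assms
  proof (induction B)
    case (insert b B)
    have b: "b \<notin> vec.span B" and B: "vec.independent B"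
      using insert vec.independent_insert[of b B] by (auto split: if_splits)
    have "bij_betw (\<lambda>(k, v). k *s b + v) (UNIV \<times> vec.span B) (vec.span (insert b B))"
      unfolding bij_betw_def
    proof
      show "inj_on (\<lambda>(k, v). k *s b + v) (UNIV \<times> vec.span B)"
      proof (rule inj_onI, clarify)
        fix k v k' v'
        assume v: "v \<in> vec.span B" "v' \<in> vec.span B" and eq: "k *s b + v = k' *s b + v'"
        then have "(k - k') *s b = v' - v" by (simp add: algebra_simps)
        then have s: "(k - k') *s b \<in> vec.span B" using v by (simp add: vec.span_diff)
        have "k = k'"
        proof (rule ccontr)
          assume "k \<noteq> k'"
          then have "b = inverse (k - k') *s ((k - k') *s b)" by simp
          then show False using b s by (metis vec.span_scale)
        qed
        then show "k = k' \<and> v = v'" using eq by simp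
      qed
      have "\<exists>k. \<exists>v\<in>vec.span B. x = k *s b + v" if "x - k *s b \<in> vec.span B" for x k
        using that by (intro exI[of _ k] bexI[of _ "x - k *s b"]) auto
      then show "(\<lambda>(k, v). k *s b + v) ` (UNIV \<times> vec.span B) = vec.span (insert b B)"
        by (auto simp: vec.span_insert image_iff) (metis add_diff_cancel_left')
    qed
    then show ?case
      using insert B by (metis bij_betw_same_card card_cartesian_product card_insert_disjoint power_Suc)
  qed simp
qed

lemma card_vec_subspace:
  fixes V :: "(('f::{field,finite}) ^ 'n) set"
  assumes "vec.subspace V"
  shows "card V = CARD('f) ^ vec.dim V"
proof -
  obtain B where "B \<subseteq> V" "vec.independent B" "V \<subseteq> vec.span B" "card B = vec.dim V"
    using vec.basis_exists by blast
  then show ?thesis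
    using card_vec_span_independent assms by (metis vec.span_subspace)
qed

section \<open>Moments of the number of zeros\<close>

text \<open>Double counting of the pairs of a word \<open>c\<close> and a \<open>j\<close>-set
  \<open>T\<close> inside its zeros; every \<open>T\<close> belongs to the same number of
  words.\<close>

lemma sum_binomial_card_zeros:
  fixes C :: "(('f::{field,finite}) ^ 'n) set"
  assumes C: "vec.subspace C" and d: "\<And>y. y \<in> dual_code C \<Longrightarrow> y \<noteq> 0 \<Longrightarrow> j < hamming_weight y"
  shows "CARD('f) ^ j * (\<Sum>c\<in>C. card (zeros c) choose j) = (CARD('n) choose j) * card C"
proof -
  have "(\<Sum>c\<in>C. card (zeros c) choose j) = (\<Sum>c\<in>C. card {T \<in> {T. card T = j}. T \<subseteq> zeros c})"
    by (intro sum.cong refl) (simp add: n_subsets[symmetric] conj_commute)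
  also have "\<dots> = (\<Sum>T | card T = j. card {c \<in> C. T \<subseteq> zeros c})"
    using sum.swap_restrict[of C "{T. card T = j}" "\<lambda>c y. 1::nat" "\<lambda>c T. T \<subseteq> zeros c"] by simp
  finally have "CARD('f) ^ j * (\<Sum>c\<in>C. card (zeros c) choose j)
     = (\<Sum>T | card T = j. CARD('f) ^ j * card {c \<in> C. T \<subseteq> zeros c})"
    by (simp add: sum_distrib_left)
  also have "\<dots> = (\<Sum>T | T \<subseteq> (UNIV :: 'n set) \<and> card T = j. card C)"
    using card_vanishing_words[OF C] d by (intro sum.cong) auto
  also have "\<dots> = (CARD('n) choose j) * card C"
    by (simp only: sum_constant n_subsets[OF finite] of_nat_id)
  finally show ?thesis .
qed

lemma falling_moment_zeros:
  fixes C :: "(('f::{field,finite}) ^ 'n) set"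
  assumes C: "vec.subspace C" and d: "\<And>y. y \<in> dual_code C \<Longrightarrow> y \<noteq> 0 \<Longrightarrow> j < hamming_weight y"
  shows "(\<Sum>c\<in>C. \<Prod>i=0..<j. real (card (zeros c)) - real i)
    = card C * (\<Prod>i=0..<j. real CARD('n) - real i) / real CARD('f) ^ j"
proof -
  have F: "(\<Prod>i=0..<j. real a - real i) = fact j * real (a choose j)" for a
    by (simp add: binomial_gbinomial gbinomial_prod_rev)
  have "real CARD('f) ^ j * (\<Sum>c\<in>C. real (card (zeros c) choose j)) = real (CARD('n) choose j) * real (card C)"
    using arg_cong[OF sum_binomial_card_zeros[OF C d], of real] by simp
  moreover have "CARD('f) > 0" by simp
  ultimately show ?thesis
    unfolding F sum_distrib_left[symmetric] by (simp add: field_simps)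
qed

section \<open>Moment equations for two nonzero weights\<close>

lemma prod_upto_numerals:
  fixes f :: "nat \<Rightarrow> 'a::comm_monoid_mult"
  shows "(\<Prod>i=0..<0. f i) = 1" "(\<Prod>i=0..<1. f i) = f 0" "(\<Prod>i=0..<2. f i) = f 0 * f 1"
  "(\<Prod>i=0..<3. f i) = f 0 * f 1 * f 2" "(\<Prod>i=0..<4. f i) = f 0 * f 1 * f 2 * f 3"
  "(\<Prod>i=0..<5. f i) = f 0 * f 1 * f 2 * f 3 * f 4"
  by (simp_all add: numeral_eq_Suc)

text \<open>\<open>x1\<close> and \<open>x2\<close> count zeros, so they are the length minus the
  weights. \<open>n\<close> and \<open>q\<close> are real copies of length and size, which makes the
  moments polynomial identities with division.\<close>

locale two_weight_ternary =
  fixes C :: "(('f::{field,finite}) ^ 'n) set" and x1 x2 :: nat and n q :: real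
  assumes n_eq: "n = real CARD('n)" and q_eq: "q = real (card C)" and card_field: "CARD('f) = 3"
    and subspace: "vec.subspace C"
    and zeros_cases: "\<And>c. c \<in> C \<Longrightarrow> c \<noteq> 0 \<Longrightarrow> card (zeros c) = x1 \<or> card (zeros c) = x2"
begin

abbreviation "X c \<equiv> real (card (zeros (c :: 'f ^ 'n)))"

definition dual_weights_exceed :: "nat \<Rightarrow> bool" where
  "dual_weights_exceed j \<longleftrightarrow> (\<forall>y\<in>dual_code C. y \<noteq> 0 \<longrightarrow> j < hamming_weight y)"

lemma q_pos: "q > 0"
  using vec.subspace_0[OF subspace] by (auto simp: card_gt_0_iff q_eq)

lemma n_pos: "n > 0" by (simp add: n_eq)

lemma moment:
  assumes "dual_weights_exceed j" "i \<le> j"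
  shows "(\<Sum>c\<in>C. \<Prod>l=0..<i. X c - real l) = q * (\<Prod>l=0..<i. n - real l) / 3 ^ i"
  using falling_moment_zeros[OF subspace, of i] assms card_field
  by (force simp: dual_weights_exceed_def n_eq q_eq)

lemma moments:
  "(\<Sum>c\<in>C. 1) = q"
  "dual_weights_exceed 1 \<Longrightarrow> (\<Sum>c\<in>C. X c) = q * n / 3"
  "dual_weights_exceed 2 \<Longrightarrow> (\<Sum>c\<in>C. X c * (X c - 1)) = q * (n * (n - 1)) / 9"
  "dual_weights_exceed 3 \<Longrightarrow> (\<Sum>c\<in>C. X c * (X c - 1) * (X c - 2)) = q * (n * (n - 1) * (n - 2)) / 27"
  "dual_weights_exceed 4 \<Longrightarrow> (\<Sum>c\<in>C. X c * (X c - 1) * (X c - 2) * (X c - 3))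
      = q * (n * (n - 1) * (n - 2) * (n - 3)) / 81"
  "dual_weights_exceed 5 \<Longrightarrow> (\<Sum>c\<in>C. X c * (X c - 1) * (X c - 2) * (X c - 3) * (X c - 4))
      = q * (n * (n - 1) * (n - 2) * (n - 3) * (n - 4)) / 243"
  using moment[of 1 1] moment[of 2 2] moment[of 3 3] moment[of 4 4] moment[of 5 5]
  by (simp_all add: prod_upto_numerals q_eq del: One_nat_def)

lemma dual_weights_exceed_mono: "dual_weights_exceed j \<Longrightarrow> i \<le> j \<Longrightarrow> dual_weights_exceed i"
  by (force simp: dual_weights_exceed_def)

lemma zeros_0: "card (zeros (0 :: 'f ^ 'n)) = CARD('n)"
  by (simp add: zeros_def)

lemma annihilator: "c \<in> C \<Longrightarrow> (X c - x1) * (X c - x2) * (X c - n) = 0"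
  using zeros_cases[of c] zeros_0 by (cases "c = 0") (auto simp: n_eq)

text \<open>\<open>(X - x1) (X - x2)\<close> vanishes on all nonzero words, so its sum over the code
  is the contribution of the zero word. This determines \<open>q\<close>.\<close>

lemma moment_equation_2:
  assumes "dual_weights_exceed 2"
  shows "q * (n^2 + 2 * n - 3 * (real x1 + x2) * n + 9 * x1 * x2) = 9 * (n - x1) * (n - x2)"
proof -
  have "(\<Sum>c\<in>C. (X c - x1) * (X c - x2)) = (\<Sum>c\<in>C. if c = 0 then (n - x1) * (n - x2) else 0)"
    using zeros_cases zeros_0 by (intro sum.cong) (auto simp: n_eq)
  also have "\<dots> = (n - x1) * (n - x2)" using vec.subspace_0[OF subspace] by simp
  finally have "(n - x1) * (n - x2) = (\<Sum>c\<in>C. (X c - x1) * (X c - x2))" ..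
  also have "\<dots> = (\<Sum>c\<in>C. X c * (X c - 1) + (1 - real x1 - x2) * X c + x1 * x2 * 1)"
    by (intro sum.cong refl) (simp add: algebra_simps)
  also have "\<dots> = q * (n * (n - 1)) / 9 + (1 - real x1 - x2) * (q * n / 3) + x1 * x2 * q"
    using moments dual_weights_exceed_mono[OF assms] assms
    by (simp only: sum.distrib sum_distrib_left[symmetric]) simp
  finally show ?thesis by (simp add: field_simps power2_eq_square)
qed

text \<open>\<open>X - x2\<close> survives only on the zero word and on the nonzero words with
  \<open>x1\<close> zeros. Their number enters as an integer, which is later the source of
  divisibility.\<close>

lemma moment_equation_1:
  assumes "dual_weights_exceed 1" "x1 \<noteq> x2"
  shows "q * (n - 3 * x2) = 3 * (card {c \<in> C. c \<noteq> 0 \<and> card (zeros c) = x1} * (real x1 - x2)) + 3 * (n - x2)"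
proof -
  define A where "A = {c \<in> C. c \<noteq> 0 \<and> card (zeros c) = x1}"
  have "A \<subseteq> C" by (auto simp: A_def)
  have "(\<Sum>c\<in>C. X c - x2) = (\<Sum>c\<in>C. (if c = 0 then n - x2 else 0) + (if c \<in> A then real x1 - x2 else 0))"
    using zeros_cases zeros_0 by (intro sum.cong) (auto simp: n_eq A_def)
  also have "\<dots> = (n - x2) + card A * (real x1 - x2)"
    using vec.subspace_0[OF subspace] \<open>A \<subseteq> C\<close>
    by (simp add: sum.distrib sum.inter_restrict[symmetric] Int_absorb1)
  finally show ?thesis
    using moments(1,2) assms by (simp add: sum_subtractf field_simps A_def q_eq)
qed

text \<open>Taking \<open>g = 1\<close> makes \<open>q\<close> cancel. For a binomial variable the
  factor \<open>X - n\<close> acts as \<open>-2n/3\<close> times the passage to length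
  \<open>n - 1\<close>, so what remains is the quadratic of \<open>moment_equation_2\<close> at
  \<open>n - 1\<close>.\<close>

lemma moment_equation_3:
  assumes "dual_weights_exceed 3"
  shows "(n - 1)^2 + 2 * (n - 1) - 3 * (real x1 + x2) * (n - 1) + 9 * x1 * x2 = 0"
proof -
  let ?S = "real x1 + x2" and ?P = "real x1 * x2"
  have "0 = (\<Sum>c\<in>C. (X c - x1) * (X c - x2) * (X c - n))" using annihilator by (intro sum.neutral[symmetric]) auto
  \<comment> \<open>Expansion of the cubic in falling factorials, whose sums are the known
    moments.\<close>
  also have "\<dots> = (\<Sum>c\<in>C. X c * (X c - 1) * (X c - 2) + (3 - ?S - n) * (X c * (X c - 1))
       + (1 - ?S - n + ?P + n * ?S) * X c + (- ?P * n) * 1)"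
    by (intro sum.cong refl) (simp add: algebra_simps)
  also have "\<dots> = q * (n * (n - 1) * (n - 2)) / 27 + (3 - ?S - n) * (q * (n * (n - 1)) / 9)
       + (1 - ?S - n + ?P + n * ?S) * (q * n / 3) + (- ?P * n) * q"
    using moments dual_weights_exceed_mono[OF assms] assms
    by (simp only: sum.distrib sum_distrib_left[symmetric])
  also have "\<dots> = - (2 * q * n / 27) * ((n - 1)^2 + 2 * (n - 1) - 3 * ?S * (n - 1) + 9 * ?P)"
    by (simp add: field_simps power2_eq_square)
  finally show ?thesis using q_pos n_pos by (simp add: mult.assoc)
qed

text \<open>The extra factor \<open>X\<close> shifts once more: the same quadratic appears with
  \<open>n - 2\<close>, \<open>x1 - 1\<close>, \<open>x2 - 1\<close>. Its difference from
  \<open>moment_equation_3\<close> is linear.\<close>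

lemma moment_equation_4:
  assumes "dual_weights_exceed 4" "CARD('n) \<ge> 2"
  shows "2 * n = 3 * (real x1 + x2) + 1"
proof -
  let ?S = "real x1 + x2" and ?P = "real x1 * x2"
  define Q where "Q x = (x - x1) * (x - x2) * (x - n)" for x :: real
  have "0 = (\<Sum>c\<in>C. X c * Q (X c))" using annihilator by (intro sum.neutral[symmetric]) (auto simp: Q_def)
  \<comment> \<open>Newton interpolation of the monic cubic \<open>Q\<close> at 1, 2, 3, so that
    multiplying by \<open>X\<close> again gives falling factorials.\<close>
  also have "\<dots> = (\<Sum>c\<in>C. X c * (X c - 1) * (X c - 2) * (X c - 3)
       + (Q 3 - 2 * Q 2 + Q 1) / 2 * (X c * (X c - 1) * (X c - 2))
       + (Q 2 - Q 1) * (X c * (X c - 1)) + Q 1 * X c)"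
    by (intro sum.cong refl) (simp add: Q_def field_simps)
  also have "\<dots> = q * (n * (n - 1) * (n - 2) * (n - 3)) / 81
       + (Q 3 - 2 * Q 2 + Q 1) / 2 * (q * (n * (n - 1) * (n - 2)) / 27)
       + (Q 2 - Q 1) * (q * (n * (n - 1)) / 9) + Q 1 * (q * n / 3)"
    using moments dual_weights_exceed_mono[OF assms(1)] assms(1)
    by (simp only: sum.distrib sum_distrib_left[symmetric])
  also have "\<dots> = - (2 * q * n * (n - 1) / 81)
       * ((n - 2)^2 + 2 * (n - 2) - 3 * (?S - 2) * (n - 2) + 9 * (?P - ?S + 1))"
    by (simp add: Q_def field_simps power2_eq_square)
  finally have "(n - 2)^2 + 2 * (n - 2) - 3 * (?S - 2) * (n - 2) + 9 * (?P - ?S + 1) = 0"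
    using q_pos assms(2) by (simp add: n_eq)
  then show ?thesis
    using moment_equation_3[OF dual_weights_exceed_mono[OF assms(1)]]
    by (simp add: algebra_simps power2_eq_square)
qed

text \<open>With \<open>g = X (X - 1)\<close> the quadratic appears at \<open>n - 3\<close>,
  \<open>x1 - 2\<close>, \<open>x2 - 2\<close>. Subtracting \<open>moment_equation_3\<close> gives
  \<open>2 * n = 3 * ?S - 1\<close>, against \<open>2 * n = 3 * ?S + 1\<close>.\<close>

lemma not_dual_weights_exceed_5:
  assumes "CARD('n) \<ge> 3"
  shows "\<not> dual_weights_exceed 5"
proof
  assume *: "dual_weights_exceed 5"
  let ?S = "real x1 + x2" and ?P = "real x1 * x2"
  define Q where "Q x = (x - x1) * (x - x2) * (x - n)" for x :: real
  have "0 = (\<Sum>c\<in>C. X c * (X c - 1) * Q (X c))" using annihilator by (intro sum.neutral[symmetric]) (auto simp: Q_def)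
  also have "\<dots> = (\<Sum>c\<in>C. X c * (X c - 1) * (X c - 2) * (X c - 3) * (X c - 4)
       + (Q 4 - 2 * Q 3 + Q 2) / 2 * (X c * (X c - 1) * (X c - 2) * (X c - 3))
       + (Q 3 - Q 2) * (X c * (X c - 1) * (X c - 2)) + Q 2 * (X c * (X c - 1)))"
    by (intro sum.cong refl) (simp add: Q_def field_simps)
  also have "\<dots> = q * (n * (n - 1) * (n - 2) * (n - 3) * (n - 4)) / 243
       + (Q 4 - 2 * Q 3 + Q 2) / 2 * (q * (n * (n - 1) * (n - 2) * (n - 3)) / 81)
       + (Q 3 - Q 2) * (q * (n * (n - 1) * (n - 2)) / 27) + Q 2 * (q * (n * (n - 1)) / 9)"
    using moments dual_weights_exceed_mono[OF *] *
    by (simp only: sum.distrib sum_distrib_left[symmetric])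
  also have "\<dots> = - (2 * q * n * (n - 1) * (n - 2) / 243)
       * ((n - 3)^2 + 2 * (n - 3) - 3 * (?S - 4) * (n - 3) + 9 * (?P - 2 * ?S + 4))"
    by (simp add: Q_def field_simps power2_eq_square)
  finally have "(n - 3)^2 + 2 * (n - 3) - 3 * (?S - 4) * (n - 3) + 9 * (?P - 2 * ?S + 4) = 0"
    using q_pos assms by (simp add: n_eq)
  moreover have "(n - 1)^2 + 2 * (n - 1) - 3 * ?S * (n - 1) + 9 * ?P = 0"
    using moment_equation_3[OF dual_weights_exceed_mono[OF *]] by (simp add: mult.assoc)
  moreover have "2 * n = 3 * ?S + 1"
    using moment_equation_4[OF dual_weights_exceed_mono[OF *]] assms by simp
  ultimately show False by (simp add: algebra_simps power2_eq_square)
qed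

end

section \<open>Admissible parameters\<close>

lemma not_dvd_power_3: "\<not> (p::int) dvd 3 ^ k" if "\<not> 3 dvd p" "p > 1"
proof
  assume "p dvd 3 ^ k"
  moreover have "coprime p (3 ^ k)"
    using that prime_imp_coprime[of "3::int" p] by (simp add: coprime_commute)
  ultimately have "is_unit p" by (meson coprime_common_divisor dvd_refl)
  then show False using that by simp
qed

lemma golay_parameters:
  fixes n x1 x2 q A :: int
  assumes e1: "q * (n - 3 * x2) = 3 * (A * (x1 - x2)) + 3 * (n - x2)"
    and e2: "q * (n^2 + 2 * n - 3 * (x1 + x2) * n + 9 * x1 * x2) = 9 * (n - x1) * (n - x2)"
    and e3: "(n - 1)^2 + 2 * (n - 1) - 3 * (x1 + x2) * (n - 1) + 9 * x1 * x2 = 0"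
    and e4: "2 * n = 3 * (x1 + x2) + 1"
    and q: "q = 3 ^ k" and n: "n \<ge> 5" and x: "x1 > x2"
  shows "n = 11 \<and> q = 243 \<and> x1 = 5 \<and> x2 = 2"
proof -
  \<comment> \<open>The equations \<open>e2\<close>-\<open>e4\<close> give \<open>q = 2 n^2 + 1\<close> and \<open>9 s^2 = 8 n - 7\<close>. As \<open>q\<close> is a power of 3, \<open>s = 3 e\<close>,
    and then \<open>e1\<close>, which says that a weight is attained an integral number of times, forces \<open>e\<close> to divide 126.\<close>
  define s where "s = x1 - x2"
  have S: "3 * (x1 + x2) = 2 * n - 1" using e4 by simp
  have P: "9 * (x1 * x2) = n^2 - 3 * n + 2"
    using e3 unfolding S by (simp add: algebra_simps power2_eq_square)
  have "9 * s^2 = (3 * (x1 + x2))^2 - 4 * (9 * (x1 * x2))"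
    by (simp add: s_def algebra_simps power2_eq_square)
  then have s: "9 * s^2 = 8 * n - 7" unfolding S P by (simp add: algebra_simps power2_eq_square)
  have "9 * (n - x1) * (n - x2) = 9 * n^2 - 3 * (3 * (x1 + x2)) * n + 9 * (x1 * x2)"
    by (simp add: algebra_simps power2_eq_square)
  also have "\<dots> = 2 * (2 * n^2 + 1)" unfolding S P by (simp add: algebra_simps power2_eq_square)
  also have "n^2 + 2 * n - 3 * (x1 + x2) * n + 9 * x1 * x2 = 2"
    using P unfolding S by (simp add: algebra_simps power2_eq_square)
  ultimately have q2: "q = 2 * n^2 + 1" using e2 by simp
  have "32 * q = (8 * n)^2 + 32" by (simp add: q2 power2_eq_square)
  also have "8 * n = 9 * s^2 + 7" using s by simp
  finally have qs: "32 * q = 9 * (9 * s^4 + 14 * s^2 + 9)" by (simp add: algebra_simps power2_eq_square power4_eq_xxxx)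
  \<comment> \<open>\<open>q\<close> is at least 51, so 27 divides it; this leaves a factor 3 in
    \<open>qs\<close> after cancelling 9.\<close>
  have "k \<ge> 3"
  proof (rule ccontr)
    assume "\<not> k \<ge> 3"
    then have "k \<le> 2" by simp
    then have "q \<le> 3 ^ 2" unfolding q by (intro power_increasing) auto
    moreover have "5 * 5 \<le> n * n" using n by (intro mult_mono) auto
    ultimately show False using q2 by (simp add: power2_eq_square)
  qed
  then obtain j where "k = j + 3" by (metis add.commute le_Suc_ex)
  then have "9 * (9 * s^4 + 14 * s^2 + 9) = 9 * (3 * (32 * 3 ^ j))" using qs q by (simp add: power_add)
  then have "14 * s^2 = 3 * (32 * 3 ^ j - 3 * s^4 - 3)" by simp
  then have "s^2 = 3 * (5 * s^2 - (32 * 3 ^ j - 3 * s^4 - 3))" by simp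
  then have "3 dvd s^2" by (metis dvd_triv_left)
  then have "3 dvd s" using prime_dvd_power[of "3::int" s 2] by simp
  then obtain e where e: "s = 3 * e" by blast
  have e0: "e > 0" using x e by (simp add: s_def)
  have n8: "8 * n = 81 * e^2 + 7" using s e by (simp add: power2_eq_square)
  have "x1 = x2 + 3 * e" using e by (simp add: s_def)
  then have x2: "8 * x2 = 27 * e^2 + 1 - 12 * e" using e4 n8 by simp
  \<comment> \<open>\<open>32 * q\<close>, \<open>8 * n\<close> and \<open>8 * x2\<close> are
    integer polynomials in \<open>e\<close>, so \<open>e1\<close> is multiplied by 256 before
    substituting.\<close>
  have "32 * q = 6561 * e^4 + 1134 * e^2 + 81" using qs e by (simp add: power_mult_distrib)
  moreover have "(32 * q) * (8 * n - 3 * (8 * x2)) = 256 * (q * (n - 3 * x2))"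
    by (simp add: algebra_simps)
  moreover have "q * (n - 3 * x2) = 3 * (A * (3 * e)) + 3 * (n - x2)"
    using e1 e by (simp add: s_def)
  moreover have "256 * (3 * (A * (3 * e)) + 3 * (n - x2)) = 2304 * (A * e) + 96 * (8 * n - 8 * x2)"
    by (simp add: algebra_simps)
  ultimately have "(6561 * e^4 + 1134 * e^2 + 81) * (4 + 36 * e) = 2304 * (A * e) + 96 * (54 * e^2 + 12 * e + 6)"
    unfolding n8 x2 by (simp add: algebra_simps)
  \<comment> \<open>After halving, the constant terms 324 and 576 leave 126, while every other term
    contains \<open>e\<close>.\<close>
  then have "126 = e * ((6561 * e^3 + 1134 * e) * (2 + 18 * e) + 1458 - 1152 * A - 2592 * e - 576)"
    by (simp add: algebra_simps power4_eq_xxxx power3_eq_cube power2_eq_square)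
  then have e126: "e dvd 126" by (metis dvd_triv_left)
  then have "e \<le> 126" by (simp add: zdvd_imp_le)
  then have "e \<in> set [1..126]" using e0 by simp
  then have "e = 1 \<or> e \<in> {3, 7, 9, 21, 63} \<or> e \<in> {2, 6, 14, 18, 42, 126}"
    using e126 by (auto simp: upto.simps)
  \<comment> \<open>\<open>q\<close> would be divisible by 11 for \<open>e\<close> = 3, 9, 63, by 19
    for \<open>e\<close> = 7 and by 17 for \<open>e\<close> = 21.\<close>
  moreover have "e \<noteq> 3 \<and> e \<noteq> 7 \<and> e \<noteq> 9 \<and> e \<noteq> 21 \<and> e \<noteq> 63"
    using not_dvd_power_3[of 11 k] not_dvd_power_3[of 19 k] not_dvd_power_3[of 17 k] qs e
    unfolding q[symmetric] by auto
  \<comment> \<open>For even \<open>e\<close> the right side of \<open>n8\<close> is odd.\<close>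
  moreover have "e \<notin> {2, 6, 14, 18, 42, 126}" using n8 by auto presburger+
  ultimately have "e = 1" by blast
  then show ?thesis using n8 x2 q2 \<open>x1 = x2 + 3 * e\<close> by simp
qed

text \<open>Each coordinate is either zero on all of \<open>V\<close> or zero on exactly a fraction
  \<open>1 / CARD('f)\<close> of it; sum over the coordinates.\<close>

lemma plotkin_zeros:
  fixes V :: "(('f::{field,finite}) ^ 'n) set"
  assumes V: "vec.subspace V"
  shows "CARD('n) * card V \<le> CARD('f) * (\<Sum>v\<in>V. card (zeros v))"
proof -
  have "card V \<le> CARD('f) * card {v \<in> V. v $ i = 0}" for i
  proof (cases "axis i 1 \<in> dual_code V")
    case True
    then have "{v \<in> V. v $ i = 0} = V" by (auto simp: dual_code_eq dot_axis)
    then show ?thesis by (metis One_nat_def Suc_leI finite_UNIV_card_ge_0 finite mult_1 mult_le_mono1)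
  next
    case False
    then show ?thesis using card_functional_kernel[OF V False] by (simp add: dot_axis)
  qed
  then have "(\<Sum>i\<in>(UNIV::'n set). card V) \<le> (\<Sum>i\<in>UNIV. CARD('f) * card {v \<in> V. v $ i = 0})"
    by (intro sum_mono)
  also have "\<dots> = CARD('f) * (\<Sum>v\<in>V. card (zeros v))"
    using sum.swap_restrict[of V "UNIV :: 'n set" "\<lambda>v i. 1::nat" "\<lambda>v i. v $ i = 0"]
    by (simp add: sum_distrib_left[symmetric] zeros_def)
  finally show ?thesis by simp
qed

context two_weight_ternary
begin

text \<open>The moment equations are real, the divisibility argument is integral; each equation is
  pulled back along \<open>of_int\<close>.\<close>

lemma golay_parameters_code:
  assumes "dual_weights_exceed 4" "CARD('n) \<ge> 5" "x1 > x2"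
  shows "CARD('n) = 11 \<and> card C = 243 \<and> x1 = 5 \<and> x2 = 2"
proof -
  let ?n = "int CARD('n)" and ?q = "int (card C)"
  let ?A = "int (card {c \<in> C. c \<noteq> 0 \<and> card (zeros c) = x1})"
  note ex = dual_weights_exceed_mono[OF assms(1)]
  have "real_of_int (?q * (?n - 3 * x2)) = real_of_int (3 * (?A * (int x1 - x2)) + 3 * (?n - x2))"
    using moment_equation_1 ex assms by (simp add: n_eq q_eq)
  then have "?q * (?n - 3 * x2) = 3 * (?A * (int x1 - x2)) + 3 * (?n - x2)"
    by (simp only: of_int_eq_iff)
  moreover have "real_of_int (?q * (?n^2 + 2 * ?n - 3 * (int x1 + x2) * ?n + 9 * x1 * x2))
      = real_of_int (9 * (?n - x1) * (?n - x2))"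
    using moment_equation_2 ex by (simp add: n_eq q_eq)
  then have "?q * (?n^2 + 2 * ?n - 3 * (int x1 + x2) * ?n + 9 * x1 * x2) = 9 * (?n - x1) * (?n - x2)"
    by (simp only: of_int_eq_iff)
  moreover have "real_of_int ((?n - 1)^2 + 2 * (?n - 1) - 3 * (int x1 + x2) * (?n - 1) + 9 * x1 * x2) = real_of_int 0"
    using moment_equation_3 ex by (simp add: n_eq)
  then have "(?n - 1)^2 + 2 * (?n - 1) - 3 * (int x1 + x2) * (?n - 1) + 9 * x1 * x2 = 0"
    by (simp only: of_int_eq_iff)
  moreover have "real_of_int (2 * ?n) = real_of_int (3 * (int x1 + x2) + 1)"
    using moment_equation_4 assms by (simp add: n_eq)
  then have "2 * ?n = 3 * (int x1 + x2) + 1"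
    by (simp only: of_int_eq_iff)
  moreover have "?q = 3 ^ vec.dim C" using card_vec_subspace[OF subspace] card_field by simp
  ultimately have "?n = 11 \<and> ?q = 243 \<and> int x1 = 5 \<and> int x2 = 2"
    using assms by (intro golay_parameters) auto
  then show ?thesis by auto
qed

text \<open>For each of the six pairs with \<open>x2 < x1 \<le> 3\<close>,
  \<open>moment_equation_3\<close> is a quadratic in \<open>n - 1\<close>. Three have no real root,
  one has only roots below 3, and two leave \<open>n = 5\<close> and \<open>n = 8\<close>.\<close>

lemma card_zeros_gt_3:
  assumes d: "dual_weights_exceed 3" and n4: "CARD('n) \<ge> 4" and x21: "x2 < x1"
  shows "x1 > 3"
proof (rule ccontr)
  assume "\<not> x1 > 3"
  then have x: "x2 < x1" "x1 \<le> 3" using x21 by auto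
  define y where "y = n - 1"
  have y3: "y \<ge> 3" using n4 by (simp add: y_def n_eq)
  have e3: "y^2 + 2 * y - 3 * (real x1 + x2) * y + 9 * x1 * x2 = 0"
    using moment_equation_3[OF d] by (simp add: y_def)
  have e2: "q * (n^2 + 2 * n - 3 * (real x1 + x2) * n + 9 * x1 * x2) = 9 * (n - x1) * (n - x2)"
    using moment_equation_2 dual_weights_exceed_mono[OF d] by simp
  consider "x1 = 1" "x2 = 0" | "x1 = 2" "x2 = 0" | "x1 = 3" "x2 = 0"
    | "x1 = 2" "x2 = 1" | "x1 = 3" "x2 = 1" | "x1 = 3" "x2 = 2"
    using x by linarith
  then show False
  proof cases
    case 1
    then have "y * (y - 1) = 0" using e3 by (simp add: algebra_simps power2_eq_square)
    then show False using y3 by simp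
  next
    case 2
    then have "y * (y - 4) = 0" using e3 by (simp add: algebra_simps power2_eq_square)
    then have n5: "n = 5" using y3 by (simp add: y_def)
    then have "q = 27" using e2 2 by simp
    then have "card C = 27" by (simp add: q_eq)
    moreover have N: "CARD('n) = 5" using n5 by (simp add: n_eq)
    ultimately have D: "card (dual_code C) = 9" using card_dual_code[OF subspace] card_field by simp
    \<comment> \<open>Nonzero dual words have weight at least 4, hence at most one zero. The total
      is at most 5 + 8 = 13, whereas the Plotkin bound would need 45 \<le> 39.\<close>
    have "(\<Sum>v\<in>dual_code C. card (zeros v)) \<le> (\<Sum>v\<in>dual_code C. (if v = 0 then 4 else 0) + 1)"
    proof (intro sum_mono)
      fix v assume "v \<in> dual_code C"
      then have "v = 0 \<or> hamming_weight v \<ge> 4" using d by (force simp: dual_weights_exceed_def)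
      then show "card (zeros v) \<le> (if v = 0 then 4 else 0) + 1"
        using card_zeros(2)[of v] zeros_0 N by auto
    qed
    also have "\<dots> = 13"
      using vec.subspace_0[OF subspace_dual_code[of C]] D by (simp add: sum.distrib sum_Suc)
    finally show False
      using plotkin_zeros[OF subspace_dual_code[of C]] N D card_field by simp
  next
    case 3
    then have "y * (y - 7) = 0" using e3 by (simp add: algebra_simps power2_eq_square)
    then have n8: "n = 8" using y3 by (simp add: y_def)
    then have "q = 45" using e2 3 by simp
    then have "int (card C) = 45" by (simp add: q_eq)
    then have "(3::int) ^ vec.dim C = 45"
      using card_vec_subspace[OF subspace] card_field by simp
    then show False using not_dvd_power_3[of 5 "vec.dim C"] by simp
  next
    case 4
    then have "(y - 7/2)^2 = - 23/4" using e3 by (simp add: algebra_simps power2_eq_square)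
    then show False using zero_le_power2[of "y - 7/2"] by simp
  next
    case 5
    then have "(y - 5)^2 = - 2" using e3 by (simp add: algebra_simps power2_eq_square)
    then show False using zero_le_power2[of "y - 5"] by simp
  next
    case 6
    then have "(y - 13/2)^2 = - 47/4" using e3 by (simp add: algebra_simps power2_eq_square)
    then show False using zero_le_power2[of "y - 13/2"] by simp
  qed
qed

end

section \<open>The cyclic Golay code\<close>

text \<open>Only the cardinality of the field is given. In characteristic 2 a third element
  \<open>z\<close> would bring a fourth, \<open>z + 1\<close>; so 0, 1, -1 are distinct and exhaust
  the field, which forces 1 + 1 = -1.\<close>

lemma field_card_3:
  assumes "CARD('f::field) = 3"
  shows "(x::'f) = 0 \<or> x = 1 \<or> x = - 1" and "(1::'f) \<noteq> - 1" and "(3::'f) = 0"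
proof -
  have fin: "finite (UNIV :: 'f set)" using assms by (metis card.infinite zero_neq_numeral)
  show ne: "(1::'f) \<noteq> - 1"
  proof
    assume "(1::'f) = - 1"
    then have two: "z + z = 0" for z :: 'f
      by (metis add.right_inverse distrib_left mult.right_neutral mult_zero_right)
    have "UNIV \<noteq> {0, 1 :: 'f}"
    proof
      assume "UNIV = {0, 1 :: 'f}"
      then have "CARD('f) = card {0, 1 :: 'f}" by (rule arg_cong)
      then show False using assms by simp
    qed
    then obtain z :: 'f where z: "z \<noteq> 0" "z \<noteq> 1" by blast
    then have "z + 1 \<notin> {0, 1, z}" using two[of 1] by (auto simp: add_eq_0_iff2)
    then have "card {0, 1, z, z + 1} = 4" using z by auto
    then show False using card_mono[OF fin, of "{0, 1, z, z + 1}"] assms by simp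
  qed
  have "card {0, 1, - 1 :: 'f} = CARD('f)" using ne assms by simp
  then have U: "{0, 1, - 1 :: 'f} = UNIV" using card_subset_eq[OF fin subset_UNIV] by blast
  then show "x = 0 \<or> x = 1 \<or> x = - 1" by blast
  have "(1::'f) + 1 \<in> {0, 1, - 1}" using U by blast
  moreover have "(1::'f) + 1 \<noteq> 1"
    by (simp only: add_cancel_left_right one_neq_zero not_False_eq_True)
  moreover have "(1::'f) + 1 \<noteq> 0" using ne by (simp only: eq_neg_iff_add_eq_0 not_False_eq_True)
  ultimately have "(1::'f) + 1 = - 1" by blast
  then have "(1::'f) + 1 + 1 = 0" by simp
  then show "(3::'f) = 0" by simp
qed

lemma golay_generator_values:
  "golay_generator (0::11) = (- 1 :: 'f::field)" "golay_generator (1::11) = (0 :: 'f::field)"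
  "golay_generator (2::11) = (1 :: 'f::field)" "golay_generator (3::11) = (- 1 :: 'f::field)"
  "golay_generator (4::11) = (1 :: 'f::field)" "golay_generator (5::11) = (1 :: 'f::field)"
  "golay_generator (6::11) = (0 :: 'f::field)" "golay_generator (7::11) = (0 :: 'f::field)"
  "golay_generator (8::11) = (0 :: 'f::field)" "golay_generator (9::11) = (0 :: 'f::field)"
  "golay_generator (10::11) = (0 :: 'f::field)"
  "golay_generator (- 1::11) = (0 :: 'f::field)" "golay_generator (- 2::11) = (0 :: 'f::field)"
  "golay_generator (- 3::11) = (0 :: 'f::field)" "golay_generator (- 4::11) = (0 :: 'f::field)"
  "golay_generator (- 5::11) = (0 :: 'f::field)" "golay_generator (- 6::11) = (1 :: 'f::field)"
  "golay_generator (- 7::11) = (1 :: 'f::field)" "golay_generator (- 8::11) = (- 1 :: 'f::field)"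
  "golay_generator (- 9::11) = (1 :: 'f::field)" "golay_generator (- 10::11) = (0 :: 'f::field)"
  by (simp_all add: golay_generator_def)

lemma exhaust_11:
  "(s::11) \<in> {0, 1, 2, 3, 4, 5, 6, 7, 8, 9, 10}"
proof (cases s)
  case (of_int z)
  then have "z \<in> set [0..10]" by simp
  then show ?thesis unfolding of_int(1) by (auto simp: upto.simps)
qed

text \<open>Up to signs this is the form \<open>(I | S | 1)\<close>: each check contains exactly one
  of the positions 0, 1, 2, 3, 8, position 7 always has coefficient 1, and each check omits one of
  5, 6, 4, 10, 9. The checks are tested on the eleven shifts and extended linearly.\<close>

lemma cyclic_golay_parity_checks:
  assumes F: "CARD('f::field) = 3" and x: "(x :: 'f ^ 11) \<in> cyclic_golay_code"
  shows "x$0 + x$6 + x$4 + x$10 + x$9 + x$7 = 0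
    \<and> x$1 - x$5 + x$4 - x$10 - x$9 + x$7 = 0
    \<and> - x$2 + x$5 - x$6 + x$10 - x$9 + x$7 = 0
    \<and> x$3 - x$5 - x$6 - x$4 + x$9 + x$7 = 0
    \<and> - x$8 + x$5 + x$6 - x$4 - x$10 + x$7 = 0" (is "?P x")
  using x unfolding cyclic_golay_code_def
proof (induction rule: vec.span_induct_alt)
  case base
  then show ?case by simp
next
  case (step k g y)
  then obtain s where g: "g = (\<chi> i. golay_generator (i - s))" by blast
  have "?P g"
    unfolding g using exhaust_11[of s]
    by (auto simp: golay_generator_values field_card_3(3)[OF F])
  then show ?case using step.IH by (simp, intro conjI; algebra)
qed

text \<open>The generator is supported in 0 to 5 with a nonzero entry at 0, so on coordinates 0 to 5
  the first six shifts form a triangular matrix.\<close>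

lemma card_cyclic_golay_code:
  assumes F: "CARD('f::{field,finite}) = 3"
  shows "card (cyclic_golay_code :: ('f ^ 11) set) \<ge> 729"
proof -
  define g :: "11 \<Rightarrow> 'f ^ 11" where "g s = (\<chi> i. golay_generator (i - s))" for s
  define w where "w = (\<lambda>(a0, a1, a2, a3, a4, a5).
    a0 *s g 0 + a1 *s g 1 + a2 *s g 2 + a3 *s g 3 + a4 *s g 4 + a5 *s g 5)"
  have "inj w"
  proof (rule injI, simp only: split_paired_all)
    fix a0 a1 a2 a3 a4 a5 b0 b1 b2 b3 b4 b5 :: 'f
    assume "w (a0, a1, a2, a3, a4, a5) = w (b0, b1, b2, b3, b4, b5)"
    then have eq: "w (a0, a1, a2, a3, a4, a5) $ i = w (b0, b1, b2, b3, b4, b5) $ i" for i by simp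
    note E = eq[unfolded w_def g_def, simplified]
    have 0: "a0 = b0" using E[of 0] by (simp add: golay_generator_values)
    have 1: "a1 = b1" using E[of 1] 0 by (simp add: golay_generator_values)
    have 2: "a2 = b2" using E[of 2] 0 1 by (simp add: golay_generator_values)
    have 3: "a3 = b3" using E[of 3] 0 1 2 by (simp add: golay_generator_values)
    have 4: "a4 = b4" using E[of 4] 0 1 2 3 by (simp add: golay_generator_values)
    have 5: "a5 = b5" using E[of 5] 0 1 2 3 4 by (simp add: golay_generator_values)
    show "(a0, a1, a2, a3, a4, a5) = (b0, b1, b2, b3, b4, b5)"
      using 0 1 2 3 4 5 by simp
  qed
  then have "card (range w) = 729" using F by (simp add: card_image card_prod)
  moreover have "g s \<in> cyclic_golay_code" for s
    unfolding g_def cyclic_golay_code_def by (intro vec.span_base) auto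
  then have "range w \<subseteq> cyclic_golay_code"
    unfolding cyclic_golay_code_def w_def by (auto intro!: vec.span_add vec.span_scale)
  ultimately show ?thesis using card_mono[of cyclic_golay_code "range w"] by simp
qed

lemma monomially_equivalent_cyclic_golay_code:
  fixes D :: "(('f::{field,finite}) ^ 'n) set" and u :: "'n \<Rightarrow> 'f"
  assumes F: "CARD('f) = 3" and u: "\<And>i. u i \<noteq> 0"
    and dist: "distinct [a, b, c, d, e, a', b', c', d', e', o']"
    and univ: "(UNIV :: 'n set) = {a, b, c, d, e, a', b', c', d', e', o'}"
    and cardD: "card D \<le> 729"
    and D: "\<And>y. \<lbrakk>u a * y$a + u b' * y$b' + u c' * y$c' + u d' * y$d' + u e' * y$e' + u o' * y$o' = 0;
      u b * y$b + u a' * y$a' + u c' * y$c' - u d' * y$d' - u e' * y$e' + u o' * y$o' = 0;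
      u c * y$c - u a' * y$a' - u b' * y$b' + u d' * y$d' - u e' * y$e' + u o' * y$o' = 0;
      u d * y$d + u a' * y$a' - u b' * y$b' - u c' * y$c' + u e' * y$e' + u o' * y$o' = 0;
      u e * y$e - u a' * y$a' + u b' * y$b' - u c' * y$c' - u d' * y$d' + u o' * y$o' = 0\<rbrakk> \<Longrightarrow> y \<in> D"
  shows "monomially_equivalent (cyclic_golay_code :: ('f ^ 11) set) D"
proof -
  \<comment> \<open>\<open>p\<close> and the signs in \<open>v\<close> come from putting the dual of the cyclic code into the same systematic form.\<close>
  define p :: "'n \<Rightarrow> 11" where "p i = (if i = a then 0 else if i = b then 1 else if i = c then 2
    else if i = d then 3 else if i = e then 8 else if i = a' then 5 else if i = b' then 6
    else if i = c' then 4 else if i = d' then 10 else if i = e' then 9 else 7)" for i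
  have p: "p a = 0" "p b = 1" "p c = 2" "p d = 3" "p e = 8" "p a' = 5" "p b' = 6" "p c' = 4"
    "p d' = 10" "p e' = 9" "p o' = 7"
    using dist by (auto simp: p_def)
  define v where "v i = (if i \<in> {c, e, a'} then - u i else u i)" for i
  have u2: "u i * u i = 1" for i using field_card_3(1)[OF F, of "u i"] u[of i] by auto
  \<comment> \<open>The three products equal to -1 give exactly the sign changes that turn the
    equations for \<open>D\<close> into the checks of the cyclic code.\<close>
  have uv: "u a * v a = 1" "u b * v b = 1" "u c * v c = - 1" "u d * v d = 1" "u e * v e = - 1"
    "u a' * v a' = - 1" "u b' * v b' = 1" "u c' * v c' = 1" "u d' * v d' = 1" "u e' * v e' = 1"
    "u o' * v o' = 1"
    using dist u2 by (auto simp: v_def)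
  have v: "v i \<noteq> 0" for i using u[of i] by (simp add: v_def)
  have "surj p"
  proof -
    have "s \<in> range p" for s using exhaust_11[of s] p by (auto simp: image_iff)
    then show ?thesis by blast
  qed
  have "CARD('n) = 11" unfolding univ using dist by simp
  have "inj p" using \<open>surj p\<close> \<open>CARD('n) = 11\<close> by (intro eq_card_imp_inj_on) auto
  then have bij: "bij p" using \<open>surj p\<close> by (simp add: bij_def)
  let ?m = "\<lambda>x :: 'f ^ 11. \<chi> i. v i * x $ p i"
  have "?m x \<in> D" if x: "x \<in> cyclic_golay_code" for x
  proof (rule D)
  qed (use cyclic_golay_parity_checks[OF F x] in \<open>simp_all add: p mult.assoc[symmetric] uv\<close>)
  then have sub: "?m ` cyclic_golay_code \<subseteq> D" by blast
  have "inj ?m"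
  proof (rule injI)
    fix x y assume "?m x = ?m y"
    then have "x $ p i = y $ p i" for i using v by (simp add: vec_eq_iff)
    then show "x = y" using \<open>surj p\<close> by (metis surjD vec_eq_iff)
  qed
  then have "card (?m ` cyclic_golay_code) \<ge> 729"
    using card_cyclic_golay_code[OF F] by (simp add: card_image inj_on_subset)
  \<comment> \<open>The image lies in \<open>D\<close> and has at least 729 elements, while
    \<open>D\<close> has at most 729.\<close>
  then have "D = ?m ` cyclic_golay_code"
    using cardD by (intro card_seteq[OF finite sub, symmetric]) linarith
  then show ?thesis unfolding monomially_equivalent_def using bij v by blast
qed

section \<open>Sphere packing and perfect codes\<close>

lemma card_vec_support:
  "card {x :: ('f::{field,finite}) ^ 'n. {i. x $ i \<noteq> 0} = T} = (CARD('f) - 1) ^ card T"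
proof -
  have "bij_betw (\<lambda>x. restrict (($) x) T) {x :: 'f ^ 'n. {i. x $ i \<noteq> 0} = T} (T \<rightarrow>\<^sub>E (UNIV - {0}))"
  proof (rule bij_betwI[where g = "\<lambda>f. \<chi> i. if i \<in> T then f i else 0"])
    show "restrict (($) (\<chi> i. if i \<in> T then f i else 0)) T = f"
      if "f \<in> T \<rightarrow>\<^sub>E (UNIV - {0})" for f :: "'n \<Rightarrow> 'f"
      using PiE_arb[OF that] by (auto simp: fun_eq_iff)
  qed (auto simp: vec_eq_iff PiE_iff)
  then show ?thesis by (simp add: bij_betw_same_card card_PiE card_Diff_subset)
qed

lemma card_vec_hamming_weight:
  "card {x :: ('f::{field,finite}) ^ 'n. hamming_weight x = j} = (CARD('n) choose j) * (CARD('f) - 1) ^ j"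
proof -
  have "{x :: 'f ^ 'n. hamming_weight x = j} = (\<Union>T\<in>{T. T \<subseteq> UNIV \<and> card T = j}. {x. {i. x $ i \<noteq> 0} = T})"
    by (auto simp: hamming_weight_def)
  also have "card \<dots> = (\<Sum>T | T \<subseteq> (UNIV :: 'n set) \<and> card T = j. (CARD('f) - 1) ^ j)"
    by (subst card_UN_disjoint) (auto simp: card_vec_support)
  also have "\<dots> = (CARD('n) choose j) * (CARD('f) - 1) ^ j"
    by (simp only: sum_constant n_subsets[OF finite] of_nat_id)
  finally show ?thesis .
qed

lemma hamming_dist_eq: "hamming_dist x y = hamming_weight (x - y)"
  by (simp add: hamming_dist_def hamming_weight_def)

lemma hamming_weight_diff: "hamming_weight (x - y) \<le> hamming_weight x + hamming_weight y"
proof -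
  have "card {i. (x - y) $ i \<noteq> 0} \<le> card ({i. x $ i \<noteq> 0} \<union> {i. y $ i \<noteq> 0})"
    by (intro card_mono) auto
  then show ?thesis unfolding hamming_weight_def by (meson card_Un_le le_trans)
qed

text \<open>Minimum weight 5 makes the balls of radius 2 disjoint, and 729 * 243 = 3^11 shows that
  they fill the space.\<close>

lemma perfect_code_11_6_5:
  fixes G :: "(('f::{field,finite}) ^ 'n) set"
  assumes F: "CARD('f) = 3" and N: "CARD('n) = 11" and G: "vec.subspace G"
    and cardG: "card G = 729" and d: "\<And>c. c \<in> G \<Longrightarrow> c \<noteq> 0 \<Longrightarrow> hamming_weight c \<ge> 5"
  shows "perfect_code G"
proof -
  define B where "B = {x :: 'f ^ 'n. hamming_weight x \<le> 2}"
  have "B = {x. hamming_weight x = 0} \<union> {x. hamming_weight x = 1} \<union> {x. hamming_weight x = 2}"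
    by (auto simp: B_def)
  then have "card B = card {x :: 'f ^ 'n. hamming_weight x = 0} + card {x :: 'f ^ 'n. hamming_weight x = 1}
      + card {x :: 'f ^ 'n. hamming_weight x = 2}"
    by (simp, subst card_Un_disjoint, auto, subst card_Un_disjoint, auto)
  \<comment> \<open>1 + 11 * 2 + 55 * 4.\<close>
  then have cardB: "card B = 243"
    unfolding card_vec_hamming_weight F N by (simp add: choose_two)
  have uniq: "c = c'" if "c \<in> G" "c' \<in> G" "hamming_weight (x - c) \<le> 2" "hamming_weight (x - c') \<le> 2"
    for c c' x
  proof (rule ccontr)
    assume "c \<noteq> c'"
    then have "hamming_weight (c' - c) \<ge> 5" using that G by (intro d) (auto simp: vec.subspace_diff)
    moreover have "(x - c) - (x - c') = c' - c" by simp
    then have "hamming_weight (c' - c) \<le> hamming_weight (x - c) + hamming_weight (x - c')"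
      using hamming_weight_diff[of "x - c" "x - c'"] by (simp only:)
    ultimately show False using that by linarith
  qed
  have "inj_on (\<lambda>(c, b). c + b) (G \<times> B)"
  proof (rule inj_onI, clarify)
    fix c b c' b' assume h: "c \<in> G" "c' \<in> G" "b \<in> B" "b' \<in> B" "c + b = c' + b'"
    have "c + b - c = b" by simp
    moreover have "c + b - c' = b'" using h(5) by simp
    ultimately have "hamming_weight (c + b - c) \<le> 2" "hamming_weight (c + b - c') \<le> 2"
      using h(3,4) by (simp_all only: B_def mem_Collect_eq)
    then have "c = c'" by (rule uniq[OF h(1,2)])
    then show "c = c' \<and> b = b'" using h by simp
  qed
  then have "card ((\<lambda>(c, b). c + b) ` (G \<times> B)) = CARD('f ^ 'n)"
    using cardG cardB F N by (simp add: card_image card_cartesian_product)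
  then have surj: "(\<lambda>(c, b). c + b) ` (G \<times> B) = UNIV"
    by (intro card_subset_eq) auto
  have "\<exists>!c. c \<in> G \<and> hamming_dist x c \<le> 2" for x
  proof -
    have "x \<in> (\<lambda>(c, b). c + b) ` (G \<times> B)" using surj by blast
    then obtain c b where c: "c \<in> G" and b: "b \<in> B" and x: "x = c + b" by auto
    have "x - c = b" using x by simp
    then have xc: "hamming_weight (x - c) \<le> 2" using b by (simp only: B_def mem_Collect_eq)
    show ?thesis
    proof (rule ex1I[of _ c])
      show "c \<in> G \<and> hamming_dist x c \<le> 2" using c xc by (simp only: hamming_dist_eq)
      show "c' = c" if "c' \<in> G \<and> hamming_dist x c' \<le> 2" for c'
        using uniq[of c' c x] that c xc by (simp only: hamming_dist_eq)
    qed
  qed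
  then show ?thesis unfolding perfect_code_def by blast
qed

section \<open>Uniqueness of the dual Golay code\<close>

definition exactly_one :: "bool \<Rightarrow> bool \<Rightarrow> bool \<Rightarrow> bool" where
  "exactly_one P Q R \<longleftrightarrow> (P \<and> \<not> Q \<and> \<not> R) \<or> (\<not> P \<and> Q \<and> \<not> R) \<or> (\<not> P \<and> \<not> Q \<and> R)"

lemma exactly_one_iff_of_bool:
  "exactly_one P Q R \<longleftrightarrow> of_bool P + of_bool Q + of_bool R = (1 :: nat)"
  by (cases P; cases Q; cases R) (simp_all add: exactly_one_def)

text \<open>The colour classes split 4+0, 3+1 or 2+2, with 6, 3 or 2 monochromatic pairs. The
  minimum occurs only for 2+2, which is a perfect matching of the four points.\<close>

lemma two_colouring_4:
  fixes w x y z :: bool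
  defines "e \<equiv> of_bool (w = x) + of_bool (w = y) + of_bool (w = z) + of_bool (x = y) + of_bool (x = z)
      + (of_bool (y = z) :: nat)"
  shows "e \<ge> 2" and "e = 2 \<Longrightarrow> exactly_one (w = x) (w = y) (w = z) \<and> (w = x \<longleftrightarrow> y = z) \<and> (w = y \<longleftrightarrow> x = z) \<and> (w = z \<longleftrightarrow> x = y)"
  unfolding e_def by (cases w; cases x; cases y; cases z; simp add: exactly_one_def)+

lemma columns_balanced:
  fixes R :: "'a \<Rightarrow> 'a \<Rightarrow> bool"
  assumes "exactly_one (R a c = R b c) (R a d = R b d) (R a e = R b e)"
    and "exactly_one (R a b = R c b) (R a d = R c d) (R a e = R c e)"
    and "exactly_one (R a b = R d b) (R a c = R d c) (R a e = R d e)"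
    and "exactly_one (R a b = R e b) (R a c = R e c) (R a d = R e d)"
    and "exactly_one (R b a = R c a) (R b d = R c d) (R b e = R c e)"
    and "exactly_one (R b a = R d a) (R b c = R d c) (R b e = R d e)"
    and "exactly_one (R b a = R e a) (R b c = R e c) (R b d = R e d)"
    and "exactly_one (R c a = R d a) (R c b = R d b) (R c e = R d e)"
    and "exactly_one (R c a = R e a) (R c b = R e b) (R c d = R e d)"
    and "exactly_one (R d a = R e a) (R d b = R e b) (R d c = R e c)"
    and "R a c = R b c"
  shows "R b a = R d a \<or> R b a = R e a"
   and "R b a = R d a \<Longrightarrow> 
    (R d c \<noteq> R a c \<and> R e c \<noteq> R a c) \<and>
    (R c a \<noteq> R b a \<and> R e a \<noteq> R b a) \<and>
    (R e b = R a b \<and> R c b \<noteq> R a b \<and> R d b \<noteq> R a b) \<and>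
    (R c d = R a d \<and> R b d \<noteq> R a d \<and> R e d \<noteq> R a d) \<and>
    (R d e = R a e \<and> R b e \<noteq> R a e \<and> R c e \<noteq> R a e)"
proof -
  note c = assms[unfolded exactly_one_iff_of_bool]
  note l = two_colouring_4(1)
  \<comment> \<open>The ten hypotheses sum to ten agreements, spread over five columns with at least
    two each; hence exactly two each.\<close>
  have A: "of_bool (R b a = R c a) + of_bool (R b a = R d a) + of_bool (R b a = R e a) + of_bool (R c a = R d a) + of_bool (R c a = R e a) + of_bool (R d a = R e a) = (2::nat)"
   and "of_bool (R a b = R c b) + of_bool (R a b = R d b) + of_bool (R a b = R e b) + of_bool (R c b = R d b) + of_bool (R c b = R e b) + of_bool (R d b = R e b) = (2::nat)"
   and "of_bool (R a c = R b c) + of_bool (R a c = R d c) + of_bool (R a c = R e c) + of_bool (R b c = R d c) + of_bool (R b c = R e c) + of_bool (R d c = R e c) = (2::nat)"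
   and "of_bool (R a d = R b d) + of_bool (R a d = R c d) + of_bool (R a d = R e d) + of_bool (R b d = R c d) + of_bool (R b d = R e d) + of_bool (R c d = R e d) = (2::nat)"
   and "of_bool (R a e = R b e) + of_bool (R a e = R c e) + of_bool (R a e = R d e) + of_bool (R b e = R c e) + of_bool (R b e = R d e) + of_bool (R c e = R d e) = (2::nat)"
    using c(1-10) l[of "R b a" "R c a" "R d a" "R e a"] l[of "R a b" "R c b" "R d b" "R e b"]
      l[of "R a c" "R b c" "R d c" "R e c"] l[of "R a d" "R b d" "R c d" "R e d"]
      l[of "R a e" "R b e" "R c e" "R d e"] by linarith+
  note B = this[THEN two_colouring_4(2)]
  \<comment> \<open>Column \<open>c\<close> pairs \<open>a\<close> with \<open>b\<close>, hence
    \<open>d\<close> with \<open>e\<close>. These two rows agree nowhere else, so in column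
    \<open>a\<close> the partner of \<open>b\<close> is \<open>d\<close> or
    \<open>e\<close>.\<close>
  have de_c: "R d c = R e c" "R a c \<noteq> R d c" "R a c \<noteq> R e c"
    using B(3) assms(11) by (auto simp: exactly_one_def)
  then have de: "R d a \<noteq> R e a" "R d b \<noteq> R e b" using assms(10) by (auto simp: exactly_one_def)
  then show "R b a = R d a \<or> R b a = R e a" using B(1) by (auto simp: exactly_one_def)
  assume bd: "R b a = R d a"
  then have ce_a: "R c a = R e a" "R b a \<noteq> R c a" "R b a \<noteq> R e a"
    using B(1) by (auto simp: exactly_one_def)
  then have "R c b \<noteq> R e b" using assms(9) by (auto simp: exactly_one_def)
  then have ae_b: "R a b = R e b" "R a b \<noteq> R c b" "R a b \<noteq> R d b"
    using B(2) de by (auto simp: exactly_one_def)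
  have ab: "R a d \<noteq> R b d" "R a e \<noteq> R b e" using assms(1,11) by (auto simp: exactly_one_def)
  have "R a d \<noteq> R e d" using ae_b assms(4) by (auto simp: exactly_one_def)
  then have ac_d: "R a d = R c d" using ab B(4) by (auto simp: exactly_one_def)
  then have "R a e \<noteq> R c e" using assms(2) by (auto simp: exactly_one_def)
  then have "R a e = R d e" using ab B(5) by (auto simp: exactly_one_def)
  then show "(R d c \<noteq> R a c \<and> R e c \<noteq> R a c) \<and>
    (R c a \<noteq> R b a \<and> R e a \<noteq> R b a) \<and>
    (R e b = R a b \<and> R c b \<noteq> R a b \<and> R d b \<noteq> R a b) \<and>
    (R c d = R a d \<and> R b d \<noteq> R a d \<and> R e d \<noteq> R a d) \<and>
    (R d e = R a e \<and> R b e \<noteq> R a e \<and> R c e \<noteq> R a e)"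
    using de_c ce_a ae_b ab ac_d \<open>R a d \<noteq> R e d\<close> \<open>R a e \<noteq> R c e\<close> by metis
qed

lemma exactly_one_Ex1:
  assumes "\<exists>!k. k \<in> {x, y, z} \<and> P k" "distinct [x, y, z]"
  shows "exactly_one (P x) (P y) (P z)"
  using assms unfolding exactly_one_def by auto

lemma card_5_labels:
  assumes "card I = 5" "a \<in> I" "b \<in> I" "c \<in> I" "distinct [a, b, c]"
  obtains d e where "I = {a, b, c, d, e}" "distinct [a, b, c, d, e]"
proof -
  have "finite I" using assms(1) by (metis card.infinite zero_neq_numeral)
  then have "card (I - {a, b, c}) = 2" using assms by (simp add: card_Diff_subset)
  then obtain d e where de: "I - {a, b, c} = {d, e}" "d \<noteq> e" by (auto simp: card_2_iff)
  then have "I = {a, b, c, d, e}" using assms by blast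
  moreover have "distinct [a, b, c, d, e]" using de assms(5) by auto
  ultimately show ?thesis using that by blast
qed

text \<open>
  If the colouring \<open>R _ k\<close> of the four rows other than \<open>k\<close> is read as a partition, every pair of rows
  lies in one class for exactly one \<open>k\<close>. Counting shows that all partitions are perfect matchings, so
  the edges of the complete graph on five vertices are decomposed into five near-perfect matchings, and this decomposition
  is unique up to relabelling.
\<close>

lemma agreement_labelling:
  fixes R :: "'a \<Rightarrow> 'a \<Rightarrow> bool"
  assumes I: "card I = 5"
    and R: "\<And>i j. i \<in> I \<Longrightarrow> j \<in> I \<Longrightarrow> i \<noteq> j \<Longrightarrow> \<exists>!k. k \<in> I - {i, j} \<and> R i k = R j k"
  obtains a b c d e where "I = {a, b, c, d, e}" "distinct [a, b, c, d, e]"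
    "R b c = R a c" "R d c \<noteq> R a c" "R e c \<noteq> R a c"
    "R d a = R b a" "R c a \<noteq> R b a" "R e a \<noteq> R b a"
    "R e b = R a b" "R c b \<noteq> R a b" "R d b \<noteq> R a b"
    "R c d = R a d" "R b d \<noteq> R a d" "R e d \<noteq> R a d"
    "R d e = R a e" "R b e \<noteq> R a e" "R c e \<noteq> R a e"
proof -
  obtain a b where ab: "a \<in> I" "b \<in> I" "a \<noteq> b"
    using I card_le_Suc0_iff_eq[of I] by (metis card.infinite not_numeral_le_zero numeral_le_iff One_nat_def numeral_One semiring_norm(70) zero_neq_numeral)
  obtain c where c: "c \<in> I - {a, b}" "R a c = R b c" using R[OF ab] by blast
  have abc: "c \<in> I" "distinct [a, b, c]" using ab c by auto
  obtain d e where de: "I = {a, b, c, d, e}" "distinct [a, b, c, d, e]"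
    by (rule card_5_labels[OF I ab(1,2) abc])
  \<comment> \<open>Kept general in \<open>d\<close> and \<open>e\<close>: the two possible partners
    of \<open>b\<close> in column \<open>a\<close> are handled by swapping these labels.\<close>
  have X: "exactly_one (R a c = R b c) (R a d = R b d) (R a e = R b e)"
    "exactly_one (R a b = R c b) (R a d = R c d) (R a e = R c e)"
    "exactly_one (R a b = R d b) (R a c = R d c) (R a e = R d e)"
    "exactly_one (R a b = R e b) (R a c = R e c) (R a d = R e d)"
    "exactly_one (R b a = R c a) (R b d = R c d) (R b e = R c e)"
    "exactly_one (R b a = R d a) (R b c = R d c) (R b e = R d e)"
    "exactly_one (R b a = R e a) (R b c = R e c) (R b d = R e d)"
    "exactly_one (R c a = R d a) (R c b = R d b) (R c e = R d e)"
    "exactly_one (R c a = R e a) (R c b = R e b) (R c d = R e d)"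
    "exactly_one (R d a = R e a) (R d b = R e b) (R d c = R e c)"
    if de: "I = {a, b, c, d, e}" "distinct [a, b, c, d, e]" for d e
  proof -
    have X: "exactly_one (R i x = R j x) (R i y = R j y) (R i z = R j z)"
      if "i \<in> I" "j \<in> I" "i \<noteq> j" "I - {i, j} = {x, y, z}" "distinct [x, y, z]" for i j x y z
      using exactly_one_Ex1[of x y z "\<lambda>k. R i k = R j k"] R[OF that(1-3)] that(4,5) by metis
    show "exactly_one (R a c = R b c) (R a d = R b d) (R a e = R b e)"
    "exactly_one (R a b = R c b) (R a d = R c d) (R a e = R c e)"
    "exactly_one (R a b = R d b) (R a c = R d c) (R a e = R d e)"
    "exactly_one (R a b = R e b) (R a c = R e c) (R a d = R e d)"
    "exactly_one (R b a = R c a) (R b d = R c d) (R b e = R c e)"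
    "exactly_one (R b a = R d a) (R b c = R d c) (R b e = R d e)"
    "exactly_one (R b a = R e a) (R b c = R e c) (R b d = R e d)"
    "exactly_one (R c a = R d a) (R c b = R d b) (R c e = R d e)"
    "exactly_one (R c a = R e a) (R c b = R e b) (R c d = R e d)"
    "exactly_one (R d a = R e a) (R d b = R e b) (R d c = R e c)"
      by (rule X; use de in auto)+
  qed
  from columns_balanced(1)[OF X[OF de] c(2)] show ?thesis
  proof
    assume "R b a = R d a"
    with columns_balanced(2)[OF X[OF de] c(2)] de c(2) show ?thesis by (intro that[of a b c d e]) auto
  next
    assume *: "R b a = R e a"
    have de': "I = {a, b, c, e, d}" "distinct [a, b, c, e, d]" using de by auto
    from * columns_balanced(2)[OF X[OF de'] c(2)] de' c(2) show ?thesis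
      by (intro that[of a b c e d]) auto
  qed
qed

section \<open>Normal form of a generator matrix\<close>

locale golay_dual =
  fixes C :: "(('f::{field,finite}) ^ 'n) set"
  assumes card_field: "CARD('f) = 3" and length: "CARD('n) = 11"
    and subspace: "vec.subspace C"
    and card_zeros_cases: "\<And>c. c \<in> C \<Longrightarrow> c \<noteq> 0 \<Longrightarrow> card (zeros c) = 5 \<or> card (zeros c) = 2"
    and card_vanishing: "\<And>T. card T = 4 \<Longrightarrow> card {c \<in> C. T \<subseteq> zeros c} = 3"
begin

lemmas F3 = field_card_3[OF card_field]

lemma eq_or_neg: "(x::'f) \<noteq> 0 \<Longrightarrow> y \<noteq> 0 \<Longrightarrow> x = y \<or> x = - y"
  using F3(1)[of x] F3(1)[of y] by auto

lemma nonzero_vanishing_word: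
  assumes "card T = 4"
  obtains c where "c \<in> C" "c \<noteq> 0" "T \<subseteq> zeros c"
proof -
  have "\<not> {c \<in> C. T \<subseteq> zeros c} \<subseteq> {0}"
    using card_mono[of "{0}" "{c \<in> C. T \<subseteq> zeros c}"] card_vanishing[OF assms] by auto
  then show ?thesis using that by blast
qed

text \<open>The three words vanishing on a 4-set are 0, \<open>w\<close> and \<open>- w\<close>;
  adding a coordinate where \<open>w\<close> is nonzero leaves only 0.\<close>

lemma information_set:
  obtains I where "card I = 5" "\<And>c. c \<in> C \<Longrightarrow> I \<subseteq> zeros c \<Longrightarrow> c = 0"
proof -
  obtain T :: "'n set" where T: "card T = 4"
    using obtain_subset_with_card_n[of 4 "UNIV :: 'n set"] length by auto
  obtain w where w: "w \<in> C" "w \<noteq> 0" "T \<subseteq> zeros w" using nonzero_vanishing_word[OF T] .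
  have "card (zeros w) \<noteq> CARD('n)" using card_zeros_cases[OF w(1,2)] length by auto
  then obtain i where i: "i \<notin> zeros w" by (metis UNIV_eq_I)
  then have "w $ i \<noteq> - (w $ i)" using F3(1)[of "w $ i"] F3(2) by (auto simp: zeros_def)
  then have "w \<noteq> - w" by (metis vector_uminus_component)
  then have "card {0, w, - w} = 3" using w by auto
  moreover have "{0, w, - w} \<subseteq> {c \<in> C. T \<subseteq> zeros c}"
    using w subspace vec.subspace_0 vec.subspace_neg by (auto simp: zeros_def)
  ultimately have *: "{0, w, - w} = {c \<in> C. T \<subseteq> zeros c}"
    using card_vanishing[OF T] by (intro card_subset_eq) auto
  have "c = 0" if "c \<in> C" "insert i T \<subseteq> zeros c" for c
  proof -
    have "c \<in> {0, w, - w}" unfolding * using that by simp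
    then show ?thesis using that i by (auto simp: zeros_def)
  qed
  moreover have "card (insert i T) = 5" using T w i by (subst card_insert_disjoint) auto
  ultimately show ?thesis using that by blast
qed

lemma card_split: "card A = card (A \<inter> I) + card (A - I)" for A I :: "'n set"
  by (metis card_Diff_subset_Int card_mono finite inf_le1 le_add_diff_inverse)

text \<open>The part on \<open>I\<close> is diagonal rather than the identity: the scaling of the
  rows is saved for making a further column constant 1.\<close>

definition systematic :: "'n set \<Rightarrow> ('n \<Rightarrow> 'f ^ 'n) \<Rightarrow> bool" where
  "systematic I r \<longleftrightarrow> (\<forall>i\<in>I. r i \<in> C \<and> I - {i} \<subseteq> zeros (r i) \<and> r i $ i \<noteq> 0)"

lemma systematic_rows:
  assumes I: "card I = 5" and inf: "\<And>c. c \<in> C \<Longrightarrow> I \<subseteq> zeros c \<Longrightarrow> c = 0"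
  obtains r where "systematic I r"
proof -
  have "\<exists>c. c \<in> C \<and> I - {i} \<subseteq> zeros c \<and> c $ i \<noteq> 0" if "i \<in> I" for i
  proof -
    have "card (I - {i}) = 4" using I that by simp
    then obtain c where c: "c \<in> C" "c \<noteq> 0" "I - {i} \<subseteq> zeros c" by (rule nonzero_vanishing_word)
    then have "\<not> I \<subseteq> zeros c" using inf by blast
    then have "c $ i \<noteq> 0" using c(3) by (auto simp: zeros_def)
    then show ?thesis using c by blast
  qed
  then show ?thesis using that unfolding systematic_def by metis
qed

text \<open>A row already has four zeros in \<open>I\<close>, so it has five in all.\<close>

lemma systematic_zeros_row:
  assumes I: "card I = 5" and r: "systematic I r" and i: "i \<in> I"
  shows "card (zeros (r i) - I) = 1"
proof -
  have "zeros (r i) \<inter> I = I - {i}" "r i \<noteq> 0" "r i \<in> C"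
    using r i by (auto simp: systematic_def zeros_def)
  then show ?thesis
    using card_split[of "zeros (r i)" I] card_zeros_cases[of "r i"] I i by auto
qed

text \<open>The combination has exactly three zeros in \<open>I\<close>, which again forces five in
  all.\<close>

lemma systematic_zeros_pair:
  assumes I: "card I = 5" and r: "systematic I r" and ij: "i \<in> I" "j \<in> I" "i \<noteq> j" and s: "s \<noteq> 0"
  shows "card (zeros (r i + s *s r j) - I) = 2"
proof -
  let ?c = "r i + s *s r j"
  have "?c $ i = r i $ i" "?c $ j = s * r j $ j"
    using r ij by (auto simp: systematic_def zeros_def subset_iff)
  then have ne: "?c $ i \<noteq> 0" "?c $ j \<noteq> 0" using r ij s by (auto simp: systematic_def)
  then have "?c \<noteq> 0" by (metis zero_index)
  moreover have "zeros ?c \<inter> I = I - {i, j}"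
    using r ij ne by (auto simp: systematic_def zeros_def subset_iff)
  moreover have "?c \<in> C"
    using r ij subspace by (auto simp: systematic_def vec.subspace_add vec.subspace_scale)
  moreover have "card (I - {i, j}) = 3" using I ij by (simp add: card_Diff_subset)
  ultimately show ?thesis using card_split[of "zeros ?c" I] card_zeros_cases[of ?c] by auto
qed

text \<open>The six columns outside \<open>I\<close> are \<open>z i\<close>, where row
  \<open>i\<close> alone vanishes, and one column \<open>p\<close> without zeros, which is scaled to
  1.\<close>

lemma normal_form:
  obtains I r z p where "card I = 5" "\<And>c. c \<in> C \<Longrightarrow> I \<subseteq> zeros c \<Longrightarrow> c = 0" "systematic I r"
    "inj_on z I" "\<And>i. i \<in> I \<Longrightarrow> zeros (r i) - I = {z i}" "UNIV - I = insert p (z ` I)" "p \<notin> z ` I"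
    "\<And>i. i \<in> I \<Longrightarrow> r i $ p = 1"
proof -
  obtain I where I: "card I = 5" and inf: "\<And>c. c \<in> C \<Longrightarrow> I \<subseteq> zeros c \<Longrightarrow> c = 0"
    using information_set by blast
  obtain r where r: "systematic I r" using systematic_rows[OF I inf] by blast
  have "\<exists>k. zeros (r i) - I = {k}" if "i \<in> I" for i
    using systematic_zeros_row[OF I r that] card_1_singletonE by metis
  then obtain z where z: "\<And>i. i \<in> I \<Longrightarrow> zeros (r i) - I = {z i}" by metis
  have cJ: "card (UNIV - I) = 6" using I length by (simp add: card_Diff_subset)
  have inj: "inj_on z I"
  proof (rule inj_onI, rule ccontr)
    fix i j assume ij: "i \<in> I" "j \<in> I" "z i = z j" "i \<noteq> j"
    let ?A = "zeros (r i + 1 *s r j) - I" and ?B = "zeros (r i + (- 1) *s r j) - I"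
    \<comment> \<open>Two nonzero entries are equal or opposite, so the difference or the sum of the
      rows vanishes there. Five columns would have to fit into 2 + 2 zeros.\<close>
    have "UNIV - I - {z i} \<subseteq> ?A \<union> ?B"
    proof
      fix k assume k: "k \<in> UNIV - I - {z i}"
      then have "r i $ k \<noteq> 0" "r j $ k \<noteq> 0" using z[of i] z[of j] ij by (auto simp: zeros_def)
      then show "k \<in> ?A \<union> ?B" using k eq_or_neg[of "r i $ k" "r j $ k"] by (auto simp: zeros_def)
    qed
    then have "card (UNIV - I - {z i}) \<le> card ?A + card ?B"
      by (meson card_Un_le card_mono finite le_trans)
    also have "\<dots> = 4"
      using systematic_zeros_pair[OF I r ij(1,2,4), of 1] systematic_zeros_pair[OF I r ij(1,2,4), of "- 1"]
      by simp
    also have "card (UNIV - I - {z i}) = 5" using cJ z[OF ij(1)] by (subst card_Diff_singleton) auto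
    finally show False by simp
  qed
  have zJ: "z ` I \<subseteq> UNIV - I" using z by blast
  have "card (UNIV - I - z ` I) = 1"
    using cJ I card_image[OF inj] card_Diff_subset[OF _ zJ] by simp
  then obtain p where p: "UNIV - I - z ` I = {p}" using card_1_singletonE by metis
  have rp: "r i $ p \<noteq> 0" if "i \<in> I" for i using p z[OF that] that by (auto simp: zeros_def)
  define r' where "r' i = inverse (r i $ p) *s r i" for i
  have z': "zeros (r' i) = zeros (r i)" if "i \<in> I" for i
    using rp[OF that] by (auto simp: r'_def zeros_def)
  show ?thesis
  proof (rule that[OF I inf _ inj])
    show "systematic I r'"
      using r z' rp subspace by (auto simp: systematic_def vec.subspace_scale r'_def)
    show "UNIV - I = insert p (z ` I)" using p zJ by blast
  qed (use z z' rp p in \<open>auto simp: r'_def\<close>)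
qed

text \<open>The difference of two rows has exactly two zeros outside \<open>I\<close>. One is at
  \<open>p\<close>; the other is the single agreement, and it is neither \<open>z i\<close> nor
  \<open>z j\<close>, where just one of the rows vanishes.\<close>

lemma pair_agreement:
  assumes I: "card I = 5" and r: "systematic I r" and inj: "inj_on z I"
    and z: "\<And>i. i \<in> I \<Longrightarrow> zeros (r i) - I = {z i}"
    and J: "UNIV - I = insert p (z ` I)" "p \<notin> z ` I" and p: "\<And>i. i \<in> I \<Longrightarrow> r i $ p = 1"
    and ij: "i \<in> I" "j \<in> I" "i \<noteq> j"
  shows "\<exists>!k. k \<in> I - {i, j} \<and> (r i $ z k = 1 \<longleftrightarrow> r j $ z k = 1)"
proof -
  have zI: "z k \<notin> I" if "k \<in> I" for k using J that by blast
  have zero_iff: "r l $ z k = 0 \<longleftrightarrow> k = l" if "l \<in> I" "k \<in> I" for k l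
    using z[OF that(1)] zI[OF that(2)] inj that by (auto simp: zeros_def inj_on_def set_eq_iff)
  have eq: "(r i $ z k = 1 \<longleftrightarrow> r j $ z k = 1) \<longleftrightarrow> r i $ z k = r j $ z k" if "k \<in> I - {i, j}" for k
    using zero_iff[of i k] zero_iff[of j k] that ij F3(1)[of "r i $ z k"] F3(1)[of "r j $ z k"] F3(2) by auto
  define A where "A = zeros (r i + (- 1) *s r j) - I"
  have A: "k \<in> A \<longleftrightarrow> k \<notin> I \<and> r i $ k = r j $ k" for k by (auto simp: A_def zeros_def)
  have "card A = 2" unfolding A_def using systematic_zeros_pair[OF I r ij, of "- 1"] by simp
  moreover have pA: "p \<in> A" using A J p ij by auto
  ultimately have "card (A - {p}) = 1" by simp
  then obtain w where w: "A - {p} = {w}" using card_1_singletonE by metis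
  then have wA: "w \<in> A" "w \<noteq> p" by auto
  then have "w \<in> z ` I" using A J by blast
  then obtain k where k: "k \<in> I" "w = z k" by blast
  have kk: "r i $ z k = r j $ z k" using A wA k by simp
  then have kI: "k \<in> I - {i, j}" using zero_iff ij k by (metis Diff_iff insertE singletonD)
  have uniq: "l = k" if "l \<in> I" "r i $ z l = r j $ z l" for l
  proof -
    have "z l \<in> A - {p}" using that A zI J(2) by auto
    then show ?thesis using w k that inj by (auto simp: inj_on_def)
  qed
  show ?thesis
  proof (rule ex1I[of _ k])
    show "k \<in> I - {i, j} \<and> (r i $ z k = 1 \<longleftrightarrow> r j $ z k = 1)" using eq[OF kI] kk kI by blast
  next
    fix l assume l: "l \<in> I - {i, j} \<and> (r i $ z l = 1 \<longleftrightarrow> r j $ z l = 1)"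
    then have "r i $ z l = r j $ z l" using eq[of l] by blast
    then show "l = k" using uniq l by blast
  qed
qed

lemma dual_monomially_equivalent:
  assumes cD: "card (dual_code C) \<le> 729"
  shows "monomially_equivalent (cyclic_golay_code :: ('f ^ 11) set) (dual_code C)"
proof -
  obtain I r z p where I: "card I = 5" and inf: "\<And>c. c \<in> C \<Longrightarrow> I \<subseteq> zeros c \<Longrightarrow> c = 0"
    and r: "systematic I r" and inj: "inj_on z I"
    and z: "\<And>i. i \<in> I \<Longrightarrow> zeros (r i) - I = {z i}"
    and J: "UNIV - I = insert p (z ` I)" "p \<notin> z ` I" and p: "\<And>i. i \<in> I \<Longrightarrow> r i $ p = 1"
    using normal_form by blast
  define R where "R i k \<longleftrightarrow> r i $ z k = 1" for i k
  have PA: "\<exists>!k. k \<in> I - {i, j} \<and> R i k = R j k" if "i \<in> I" "j \<in> I" "i \<noteq> j" for i j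
    unfolding R_def by (rule pair_agreement[OF I r inj z J p that])
  obtain a b c d e where lab: "I = {a, b, c, d, e}" and dist: "distinct [a, b, c, d, e]"
    and R: "R b c = R a c" "R d c \<noteq> R a c" "R e c \<noteq> R a c"
    "R d a = R b a" "R c a \<noteq> R b a" "R e a \<noteq> R b a"
    "R e b = R a b" "R c b \<noteq> R a b" "R d b \<noteq> R a b"
    "R c d = R a d" "R b d \<noteq> R a d" "R e d \<noteq> R a d"
    "R d e = R a e" "R b e \<noteq> R a e" "R c e \<noteq> R a e"
    by (rule agreement_labelling[of I R, OF I PA])
  have zI: "z k \<notin> I" if "k \<in> I" for k using J that by blast
  have zero_iff: "r l $ z k = 0 \<longleftrightarrow> k = l" if "l \<in> I" "k \<in> I" for k l
    using z[OF that(1)] zI[OF that(2)] inj that by (auto simp: zeros_def inj_on_def set_eq_iff)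
  have same: "R i k = R j k \<Longrightarrow> r i $ z k = r j $ z k"
    and diff: "R i k \<noteq> R j k \<Longrightarrow> r i $ z k = - (r j $ z k)"
    if "i \<in> I" "j \<in> I" "k \<in> I" "i \<noteq> k" "j \<noteq> k" for i j k
    using that zero_iff[of i k] zero_iff[of j k] F3(1)[of "r i $ z k"] F3(1)[of "r j $ z k"]
    by (auto simp: R_def)
  have off: "r i $ j = 0" if "i \<in> I" "j \<in> I" "i \<noteq> j" for i j
    using r that by (auto simp: systematic_def zeros_def)
  \<comment> \<open>The scalars absorb the diagonal entries and the signs of the columns. Column
    \<open>z a\<close> takes its sign from row \<open>b\<close>, because row \<open>a\<close>
    vanishes there.\<close>
  define u where "u l = (if l \<in> I then r l $ l else if l = z a then r b $ l else r a $ l)" for l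
  have mem: "a \<in> I" "b \<in> I" "c \<in> I" "d \<in> I" "e \<in> I" using lab by auto
  note ne = dist[simplified]
  have ne': "b \<noteq> a" "c \<noteq> a" "d \<noteq> a" "e \<noteq> a" "c \<noteq> b" "d \<noteq> b" "e \<noteq> b" "d \<noteq> c" "e \<noteq> c" "e \<noteq> d"
    using ne by auto
  have zne: "z x = z y \<longleftrightarrow> x = y" if "x \<in> I" "y \<in> I" for x y using inj that by (auto simp: inj_on_def)
  have pne: "p \<noteq> z x" "p \<notin> I" if "x \<in> I" for x using J that by auto
  have uI: "u x = r x $ x" if "x \<in> I" for x using that by (simp add: u_def)
  have up: "u p = 1" using pne mem p by (auto simp: u_def)
  have uz: "u (z a) = r b $ z a" "u (z b) = r a $ z b" "u (z c) = r a $ z c" "u (z d) = r a $ z d" "u (z e) = r a $ z e"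
    using zI mem zne ne by (auto simp: u_def)
  have Iz: "x \<noteq> z y" if "x \<in> I" "y \<in> I" for x y using zI that by blast
  have Ip: "x \<noteq> p" and zp: "z x \<noteq> p" if "x \<in> I" for x using J that by auto
  have dist11: "distinct [a, b, c, d, e, z a, z b, z c, z d, z e, p]"
    using ne by (simp add: mem Iz zne Ip zp)
  have univ: "(UNIV :: 'n set) = {a, b, c, d, e, z a, z b, z c, z d, z e, p}"
    using J lab by auto
  have dot11: "dot x y = x$a * y$a + x$b * y$b + x$c * y$c + x$d * y$d + x$e * y$e
     + x$(z a) * y$(z a) + x$(z b) * y$(z b) + x$(z c) * y$(z c) + x$(z d) * y$(z d) + x$(z e) * y$(z e) + x$p * y$p"
    for x y
    unfolding dot_def univ using dist11 by (simp add: add.assoc)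
  have u0: "u l \<noteq> 0" for l
  proof -
    have "u x \<noteq> 0" if "x \<in> I" for x using uI[OF that] r that by (simp add: systematic_def)
    moreover have "u (z a) \<noteq> 0" "u (z b) \<noteq> 0" "u (z c) \<noteq> 0" "u (z d) \<noteq> 0" "u (z e) \<noteq> 0"
      by (simp_all add: uz zero_iff mem ne ne')
    moreover have "l \<in> I \<or> l = p \<or> l \<in> {z a, z b, z c, z d, z e}" using univ lab by blast
    ultimately show ?thesis using up by (elim disjE) auto
  qed
  show ?thesis
  proof (rule monomially_equivalent_cyclic_golay_code[OF card_field u0 dist11 univ cD])
    fix y :: "'f ^ 'n"
    assume E: "u a * y$a + u (z b) * y$(z b) + u (z c) * y$(z c) + u (z d) * y$(z d) + u (z e) * y$(z e) + u p * y$p = 0"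
      "u b * y$b + u (z a) * y$(z a) + u (z c) * y$(z c) - u (z d) * y$(z d) - u (z e) * y$(z e) + u p * y$p = 0"
      "u c * y$c - u (z a) * y$(z a) - u (z b) * y$(z b) + u (z d) * y$(z d) - u (z e) * y$(z e) + u p * y$p = 0"
      "u d * y$d + u (z a) * y$(z a) - u (z b) * y$(z b) - u (z c) * y$(z c) + u (z e) * y$(z e) + u p * y$p = 0"
      "u e * y$e - u (z a) * y$(z a) + u (z b) * y$(z b) - u (z c) * y$(z c) - u (z d) * y$(z d) + u p * y$p = 0"
    have za: "r d $ z a = r b $ z a" "r c $ z a = - (r b $ z a)" "r e $ z a = - (r b $ z a)"
      using same diff R(4-6) mem ne by metis+
    have zb: "r e $ z b = r a $ z b" "r c $ z b = - (r a $ z b)" "r d $ z b = - (r a $ z b)"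
      using same diff R(7-9) mem ne by metis+
    have zc: "r b $ z c = r a $ z c" "r d $ z c = - (r a $ z c)" "r e $ z c = - (r a $ z c)"
      using same diff R(1-3) mem ne by metis+
    have zd: "r c $ z d = r a $ z d" "r b $ z d = - (r a $ z d)" "r e $ z d = - (r a $ z d)"
      using same diff R(10-12) mem ne by metis+
    have ze: "r d $ z e = r a $ z e" "r b $ z e = - (r a $ z e)" "r c $ z e = - (r a $ z e)"
      using same diff R(13-15) mem ne by metis+
    have diag: "r x $ z x = 0" if "x \<in> I" for x using zero_iff that by simp
    note vals = za zb zc zd ze off[OF mem(1)] off[OF mem(2)] off[OF mem(3)] off[OF mem(4)] off[OF mem(5)]
      p[OF mem(1)] p[OF mem(2)] p[OF mem(3)] p[OF mem(4)] p[OF mem(5)]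
    \<comment> \<open>With the labelled agreements, the five equations \<open>E\<close> are exactly
      orthogonality to the five rows.\<close>
    have dr: "dot (r x) y = 0" if "x \<in> I" for x
      using that E unfolding lab dot11 by (auto simp: vals diag mem ne ne' uI up uz)
    show "y \<in> dual_code C"
      unfolding dual_code_eq
    proof safe
      fix w assume w: "w \<in> C"
      define k where "k x = w $ x / r x $ x" for x
      \<comment> \<open>The combination of rows that matches \<open>w\<close> on \<open>I\<close>;
        since \<open>I\<close> is an information set it equals \<open>w\<close>.\<close>
      define v where "v = k a *s r a + k b *s r b + k c *s r c + k d *s r d + k e *s r e"
      have rC: "r x \<in> C" "r x $ x \<noteq> 0" if "x \<in> I" for x using r that by (auto simp: systematic_def)
      have "v \<in> C" using rC mem subspace by (auto simp: v_def intro!: vec.subspace_add vec.subspace_scale)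
      then have "w - v \<in> C" using w subspace by (simp add: vec.subspace_diff)
      moreover have "v $ x = w $ x" if "x \<in> I" for x
        using that unfolding lab by (auto simp: v_def k_def off rC mem ne ne')
      then have "I \<subseteq> zeros (w - v)" by (auto simp: zeros_def)
      ultimately have "w = v" using inf by fastforce
      then show "dot w y = 0" using dr mem by (simp add: v_def dot_add dot_scale)
    qed
  qed
qed

end

section \<open>The classification\<close>

lemma hamming_weight_eq_0_iff: "hamming_weight x = 0 \<longleftrightarrow> x = 0"
  by (simp add: hamming_weight_def vec_eq_iff)

theorem theorem1p1:
  fixes C :: "(('f::{field,finite}) ^ 'n) set"
    and n k d dperp t :: nat
  assumes "CARD('f) = 3"
    and "linear_code n k d C"
    and "two_weight_code C"
    and "has_min_weight (dual_code C) dperp"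
    and "AM_condition C dperp t"
  shows "(dperp = 5 \<and> linear_code 11 5 6 C \<and>
            (\<exists>G :: ('f ^ 'n) set. ternary_golay_code G \<and> C = dual_code G) \<and> t = 4)
       \<or> (dperp \<le> 4 \<and> t \<le> 3)"
proof -
  have C: "vec.subspace C" using assms(2) by (simp add: linear_code_def)
  define W where "W = {u. 0 < u \<and> words_of_weight C u \<noteq> {}}"
  obtain w1 w2 where W: "W = {w1, w2}" and w12: "w1 < w2"
  proof -
    have "card W = 2" using assms(3) by (simp add: two_weight_code_def W_def)
    then obtain x y where "W = {x, y}" "x \<noteq> y" by (auto simp: card_2_iff)
    then show ?thesis using that[of x y] that[of y x] by (cases "x < y") (auto simp: insert_commute)
  qed
  have weights: "hamming_weight c \<in> W" if "c \<in> C" "c \<noteq> 0" for c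
    using that hamming_weight_eq_0_iff[of c] by (auto simp: W_def words_of_weight_def)
  have le: "u \<le> CARD('n)" if u: "u \<in> W" for u
  proof -
    obtain c where "c \<in> C" "hamming_weight c = u" using u by (auto simp: W_def words_of_weight_def)
    then show ?thesis using card_zeros(2)[of c] by simp
  qed
  then have w_le: "w1 \<le> CARD('n)" "w2 \<le> CARD('n)" using W by auto
  define x1 x2 where "x1 = CARD('n) - w1" and "x2 = CARD('n) - w2"
  have x12: "x2 < x1" using w12 w_le by (simp add: x1_def x2_def)
  interpret two_weight_ternary C x1 x2 "real CARD('n)" "real (card C)"
  proof
    fix c assume "c \<in> C" "c \<noteq> 0"
    then have "hamming_weight c = w1 \<or> hamming_weight c = w2" using weights W by blast
    then show "card (zeros c) = x1 \<or> card (zeros c) = x2"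
      by (auto simp: card_zeros(1) x1_def x2_def)
  qed (use assms(1) C in auto)
  have dperp: "\<And>y. y \<in> dual_code C \<Longrightarrow> y \<noteq> 0 \<Longrightarrow> dperp \<le> hamming_weight y"
    using assms(4) by (auto simp: has_min_weight_def)
  then have exceed: "dual_weights_exceed j" if "j < dperp" for j
    using that by (force simp: dual_weights_exceed_def)
  have dperp_le: "dperp \<le> CARD('n)"
  proof -
    obtain y where "hamming_weight y = dperp" "y \<in> dual_code C" using assms(4) by (auto simp: has_min_weight_def)
    then show ?thesis using card_zeros(2)[of y] by simp
  qed
  \<comment> \<open>\<open>dperp_le\<close> supplies the length bound under which the factors
    \<open>n\<close>, \<open>n - 1\<close>, \<open>n - 2\<close> can be cancelled.\<close>
  have "dperp \<le> 5"
  proof (rule ccontr)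
    assume "\<not> dperp \<le> 5"
    then show False using not_dual_weights_exceed_5 exceed[of 5] dperp_le by simp
  qed
  have AM: "int dperp - int t = int (card {u \<in> W. int u \<le> int CARD('n) - int t})"
  proof -
    have "{u. words_of_weight C u \<noteq> {} \<and> 0 < u \<and> int u \<le> int CARD('n) - int t}
      = {u \<in> W. int u \<le> int CARD('n) - int t}"
      by (auto simp: W_def)
    then show ?thesis using assms(5) by (simp add: AM_condition_def)
  qed
  show ?thesis
  proof (cases "dperp = 5")
    case True
    have par: "CARD('n) = 11" "card C = 243" "x1 = 5" "x2 = 2"
      using golay_parameters_code[OF exceed[of 4]] True dperp_le x12 by auto
    then have w: "w1 = 6" "w2 = 9" using w_le by (auto simp: x1_def x2_def)
    have t: "t = 4"
    proof -
      have "card {u \<in> W. int u \<le> int CARD('n) - int t} \<le> card W"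
        unfolding W by (intro card_mono) auto
      \<comment> \<open>The count is between 0 and 2. For \<open>t\<close> = 3 it would have to be 2
        and for \<open>t\<close> = 5 it would have to be 0, but among 6 and 9 only 6 is at most 8,
        respectively 6.\<close>
      then have "t = 3 \<or> t = 4 \<or> t = 5" using AM True W w by auto
      moreover have "{u \<in> W. int u \<le> int CARD('n) - int t} = {6}" if "t = 3 \<or> t = 5"
        using that unfolding W w par by auto
      ultimately show ?thesis using AM True by auto
    qed
    have cD: "card (dual_code C) = 729" using card_dual_code[OF C] par assms(1) by simp
    have dimC: "vec.dim C = 5"
      using card_vec_subspace[OF C] par assms(1) power_inject_exp[of "3::nat" "vec.dim C" 5] by simp
    have dimD: "vec.dim (dual_code C) = 6"
      using card_vec_subspace[OF subspace_dual_code[of C]] cD assms(1)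
        power_inject_exp[of "3::nat" "vec.dim (dual_code C)" 6] by simp
    have "6 \<in> W" using W w by simp
    then have "\<exists>c\<in>C. c \<noteq> 0 \<and> hamming_weight c = 6"
      using hamming_weight_eq_0_iff by (force simp: W_def words_of_weight_def)
    then have "has_min_weight C 6" using weights W w by (force simp: has_min_weight_def)
    then have lc: "linear_code 11 5 6 C" using par C dimC by (simp add: linear_code_def)
    interpret golay_dual C
    proof
      fix T :: "'n set" assume T: "card T = 4"
      \<comment> \<open>Dual weights are at least 5, so each 4-set is the zero pattern of 243 / 81 =
        3 words.\<close>
      have "CARD('f) ^ card T * card {c \<in> C. T \<subseteq> zeros c} = card C"
        using dperp True T by (intro card_vanishing_words[OF C]) fastforce
      then show "card {c \<in> C. T \<subseteq> zeros c} = 3" using T par assms(1) by simp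
    qed (use assms(1) C par zeros_cases in auto)
    have "linear_code 11 6 5 (dual_code C)"
      using par subspace_dual_code dimD assms(4) True by (simp add: linear_code_def)
    moreover have "perfect_code (dual_code C)"
      using perfect_code_11_6_5[OF assms(1) par(1) subspace_dual_code cD] dperp True by simp
    moreover have "monomially_equivalent (cyclic_golay_code :: ('f ^ 11) set) (dual_code C)"
      using dual_monomially_equivalent cD by simp
    ultimately have "ternary_golay_code (dual_code C)"
      using assms(1) by (simp add: ternary_golay_code_def)
    then show ?thesis using True lc t dual_dual_code[OF C] by metis
  next
    case False
    then have d4: "dperp \<le> 4" using \<open>dperp \<le> 5\<close> by simp
    \<comment> \<open>\<open>t\<close> = 4 forces \<open>dperp\<close> = 4 and leaves no weight up
      to \<open>n - 4\<close>, so no nonzero word has more than three zeros.\<close>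
    have "t \<noteq> 4"
    proof
      assume t: "t = 4"
      then have "dperp = 4" and "card {u \<in> W. int u \<le> int CARD('n) - int t} = 0" using AM d4 by auto
      then have "{u \<in> W. int u \<le> int CARD('n) - int t} = {}" using W by simp
      then have "\<not> int w1 \<le> int CARD('n) - int t" using W by blast
      then have "x1 \<le> 3" using t by (simp add: x1_def)
      then show False
        using card_zeros_gt_3[OF exceed[of 3]] \<open>dperp = 4\<close> dperp_le x12 by simp
    qed
    moreover have "t \<le> dperp" using AM by simp
    ultimately show ?thesis using d4 by auto
  qed
qed

end
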